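(* Let $\mathfrak g$ be an $8$-dimensional nilpotent Lie algebra with a weakly non-nilpotent complex structure $J$. Then there is a basis of $(1,0)$-forms $\{\omega^k\}_{k=1}^4$ in terms of which the complex structure equations of $(\mathfrak g,J)$ are $$ \left\{ \begin{aligned} d\omega^1 &= 0,\\ d\omega^2 &= \omega^{13}+\omega^{1\bar 3},\\ d\omega^3 &= i\,\varepsilon\,\omega^{1\bar 1}+i\,\delta\,\omega^{1\bar 2}-i\,\delta\,\omega^{2\bar 1},\\ d\omega^4 &= a\,\omega^{12}+B\,\omega^{1\bar 1}+\nu\,\big(\omega^{23}+2\,\delta\,\varepsilon\,\omega^{1\bar 3}+\omega^{2\bar 3}\big), \end{aligned} \right. $$ where the tuple $(\varepsilon,\delta,\nu,a,B)$ satisfies $\varepsilon\in\{0,1\}$, $\delta=\pm1$, and $(\nu,a,B)$ takes one of the following values: (1) $\nu=a=B=0$; (2) $\nu=a=0$, $B=1$; (3) $\nu\in\{0,1\}$, $a=1-\nu$, and $B\in\mathbb R^{\geq 0}$; moreover, $B\in\{0,1\}$ when $\varepsilon=0$; (4) $\nu=1$, $a\in\mathbb R^{>0}$ and $B\in\mathbb C$; furthermore, when $\varepsilon=0$ one has $a=1$ and either $B\in\mathbb R^{\geq 0}$ or $\operatorname{Im}B>0$. Furthermore, different values of $(\varepsilon,\delta,\nu,a,B)$ provide non-equivalent complex structures.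
   Context: Lie algebras are real and finite-dimensional. A complex structure on a Lie algebra $\mathfrak g$ of even dimension is an endomorphism $J:\mathfrak g\to\mathfrak g$ with $J^2=-\mathrm{Id}$ and $[X,Y]+J[JX,Y]+J[X,JY]-[JX,JY]=0$ for all $X,Y\in\mathfrak g$. Given a nilpotent Lie algebra $\mathfrak g$ with complex structure $J$, the ascending $J$-compatible series is defined by $\mathfrak a_0(J)=\{0\}$ and $\mathfrak a_k(J)=\{X\in\mathfrak g\mid [X,\mathfrak g]\subseteq\mathfrak a_{k-1}(J),\ [JX,\mathfrak g]\subseteq\mathfrak a_{k-1}(J)\}$ for $k\ge1$. $J$ is weakly non-nilpotent (WnN) if $\mathfrak a_1(J)\neq\{0\}$ and there is an integer $t>0$ with $\mathfrak a_t(J)=\mathfrak a_{t+l}(J)$ for every $l\ge1$ and $\mathfrak a_t(J)\neq\mathfrak g$. $\mathfrak g^*_{\mathbb C}=\mathfrak g^*\otimes\mathbb C$ decomposes as $\mathfrak g^{1,0}_J\oplus\mathfrak g^{0,1}_J$, where $\mathfrak g_J^{1,0}$ is the $i$-eigenspace of $J$ acting on $\mathfrak g^*_{\mathbb C}$ (by $(J\alpha)(X)=\alpha(JX)$) and $\mathfrak g_J^{0,1}=\overline{\mathfrak g_J^{1,0}}$; a basis of $(1,0)$-forms is a basis of $\mathfrak g_J^{1,0}$. The differential $d$ is the Chevalley–Eilenberg differential, $d\alpha(X,Y)=-\alpha([X,Y])$, extended to the complexification. Notation: $\omega^{jk}=\omega^j\wedge\omega^k$, $\omega^{j\bar k}=\omega^j\wedge\overline{\omega^k}$.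 The complex structure equations of $(\mathfrak g,J)$ are the expressions of the differentials of a basis of $(1,0)$-forms; they determine both $\mathfrak g$ and $J$. Two complex structures $J$ on $\mathfrak g$ and $J'$ on $\mathfrak g'$ are equivalent if there is an isomorphism of Lie algebras $f:\mathfrak g\to\mathfrak g'$ with $f\circ J=J'\circ f$. *)

theory Defs
  imports "HOL-Analysis.Analysis" "HOL-Library.Function_Algebras" "HOL-Library.Nonpos_Ints"
begin

definition lie_algebra :: "('a::real_vector \<Rightarrow> 'a \<Rightarrow> 'a) \<Rightarrow> bool" where
  "lie_algebra br \<longleftrightarrow>
     bilinear br \<and> (\<forall>X. br X X = 0) \<and>
     (\<forall>X Y Z. br X (br Y Z) + br Y (br Z X) + br Z (br X Y) = 0)"

primrec lower_central :: "('a::real_vector \<Rightarrow> 'a \<Rightarrow> 'a) \<Rightarrow> nat \<Rightarrow> 'a set" where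
  "lower_central br 0 = UNIV"
| "lower_central br (Suc k) = span {br X Y | X Y. Y \<in> lower_central br k}"

definition nilpotent_lie_algebra :: "('a::real_vector \<Rightarrow> 'a \<Rightarrow> 'a) \<Rightarrow> bool" where
  "nilpotent_lie_algebra br \<longleftrightarrow> lie_algebra br \<and> (\<exists>k. lower_central br k = {0})"

definition complex_structure ::
    "('a::real_vector \<Rightarrow> 'a \<Rightarrow> 'a) \<Rightarrow> ('a \<Rightarrow> 'a) \<Rightarrow> bool" where
  "complex_structure br J \<longleftrightarrow>
     linear J \<and> (\<forall>X. J (J X) = - X) \<and>
     (\<forall>X Y. br X Y + J (br (J X) Y) + J (br X (J Y)) - br (J X) (J Y) = 0)"

primrec compat_series ::
    "('a::real_vector \<Rightarrow> 'a \<Rightarrow> 'a) \<Rightarrow> ('a \<Rightarrow> 'a) \<Rightarrow> nat \<Rightarrow> 'a set" where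
  "compat_series br J 0 = {0}"
| "compat_series br J (Suc k) =
     {X. (\<forall>Y. br X Y \<in> compat_series br J k) \<and> (\<forall>Y. br (J X) Y \<in> compat_series br J k)}"

definition weakly_non_nilpotent ::
    "('a::real_vector \<Rightarrow> 'a \<Rightarrow> 'a) \<Rightarrow> ('a \<Rightarrow> 'a) \<Rightarrow> bool" where
  "weakly_non_nilpotent br J \<longleftrightarrow>
     compat_series br J 1 \<noteq> {0} \<and>
     (\<exists>t>0. (\<forall>l\<ge>1. compat_series br J t = compat_series br J (t + l)) \<and>
            compat_series br J t \<noteq> UNIV)"

definition equivalent_structures ::
    "('a::real_vector \<Rightarrow> 'a \<Rightarrow> 'a) \<Rightarrow> ('a \<Rightarrow> 'a) \<Rightarrow>
     ('b::real_vector \<Rightarrow> 'b \<Rightarrow> 'b) \<Rightarrow> ('b \<Rightarrow> 'b) \<Rightarrow> bool" where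
  "equivalent_structures br J br' J' \<longleftrightarrow>
     (\<exists>f. linear f \<and> bij f \<and> (\<forall>X Y. f (br X Y) = br' (f X) (f Y)) \<and> f \<circ> J = J' \<circ> f)"

text \<open>
  The complexified dual of a real vector space is represented by the real-linear functionals
  with values in \<open>complex\<close>; the complex vector space structure is the pointwise one.
  Complexified 2-forms are likewise complex-valued functions of two real arguments.
\<close>

type_synonym 'a form = "'a \<Rightarrow> complex"
type_synonym 'a form2 = "'a \<Rightarrow> 'a \<Rightarrow> complex"

definition scale_form :: "complex \<Rightarrow> 'a form \<Rightarrow> 'a form" where
  "scale_form c \<alpha> = (\<lambda>X. c * \<alpha> X)"

interpretation forms: vector_space "scale_form :: complex \<Rightarrow> 'a form \<Rightarrow> 'a form"
  by unfold_locales (simp_all add: scale_form_def fun_eq_iff algebra_simps)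

definition forms_1_0 :: "('a::real_vector \<Rightarrow> 'a) \<Rightarrow> 'a form set" where
  "forms_1_0 J = {\<alpha>. linear \<alpha> \<and> (\<forall>X. \<alpha> (J X) = \<i> * \<alpha> X)}"

text \<open>Only the values of \<open>\<omega>\<close> at the indices \<open>1, \<dots>, n\<close> are relevant.\<close>

definition basis_1_0 :: "('a::real_vector \<Rightarrow> 'a) \<Rightarrow> nat \<Rightarrow> (nat \<Rightarrow> 'a form) \<Rightarrow> bool" where
  "basis_1_0 J n \<omega> \<longleftrightarrow>
     inj_on \<omega> {1..n} \<and> forms.independent (\<omega> ` {1..n}) \<and> forms.span (\<omega> ` {1..n}) = forms_1_0 J"

definition conj_form :: "'a form \<Rightarrow> 'a form" where
  "conj_form \<alpha> = (\<lambda>X. cnj (\<alpha> X))"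

definition wedge :: "'a form \<Rightarrow> 'a form \<Rightarrow> 'a form2" where
  "wedge \<alpha> \<beta> = (\<lambda>X Y. \<alpha> X * \<beta> Y - \<alpha> Y * \<beta> X)"

definition scale_form2 :: "complex \<Rightarrow> 'a form2 \<Rightarrow> 'a form2" where
  "scale_form2 c \<phi> = (\<lambda>X Y. c * \<phi> X Y)"

definition ext_diff :: "('a \<Rightarrow> 'a \<Rightarrow> 'a) \<Rightarrow> 'a form \<Rightarrow> 'a form2" where
  "ext_diff br \<alpha> = (\<lambda>X Y. - \<alpha> (br X Y))"

text \<open>The zero, sums and differences of 2-forms below are the pointwise ones of Function-Algebras.\<close>

definition structure_equations ::
    "('a \<Rightarrow> 'a \<Rightarrow> 'a) \<Rightarrow> (nat \<Rightarrow> 'a form) \<Rightarrow>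
     real \<Rightarrow> real \<Rightarrow> real \<Rightarrow> real \<Rightarrow> complex \<Rightarrow> bool" where
  "structure_equations br \<omega> \<epsilon> \<delta> \<nu> a B \<longleftrightarrow>
     (let w = (\<lambda>j k. wedge (\<omega> j) (\<omega> k));
          wb = (\<lambda>j k. wedge (\<omega> j) (conj_form (\<omega> k)))
      in ext_diff br (\<omega> 1) = 0 \<and>
         ext_diff br (\<omega> 2) = w 1 3 + wb 1 3 \<and>
         ext_diff br (\<omega> 3) =
           scale_form2 (\<i> * of_real \<epsilon>) (wb 1 1) + scale_form2 (\<i> * of_real \<delta>) (wb 1 2)
           - scale_form2 (\<i> * of_real \<delta>) (wb 2 1) \<and>
         ext_diff br (\<omega> 4) =
           scale_form2 (of_real a) (w 1 2) + scale_form2 B (wb 1 1)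
           + scale_form2 (of_real \<nu>)
               (w 2 3 + scale_form2 (2 * of_real \<delta> * of_real \<epsilon>) (wb 1 3) + wb 2 3))"

definition admissible :: "real \<Rightarrow> real \<Rightarrow> real \<Rightarrow> real \<Rightarrow> complex \<Rightarrow> bool" where
  "admissible \<epsilon> \<delta> \<nu> a B \<longleftrightarrow>
     \<epsilon> \<in> {0, 1} \<and> \<delta> \<in> {1, -1} \<and>
     ((\<nu> = 0 \<and> a = 0 \<and> B = 0) \<or>
      (\<nu> = 0 \<and> a = 0 \<and> B = 1) \<or>
      (\<nu> \<in> {0, 1} \<and> a = 1 - \<nu> \<and> B \<in> \<real>\<^sub>\<ge>\<^sub>0 \<and> (\<epsilon> = 0 \<longrightarrow> B \<in> {0, 1})) \<or>
      (\<nu> = 1 \<and> a > 0 \<and> (\<epsilon> = 0 \<longrightarrow> a = 1 \<and> (B \<in> \<real>\<^sub>\<ge>\<^sub>0 \<or> Im B > 0))))"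

end

theory Submission
  imports Defs
begin

text \<open>
  The ascending series stabilises at a proper \<open>J\<close>-invariant ideal \<open>a\<close>, and stability means that no
  nonzero \<open>J\<close>-invariant subspace is central modulo \<open>a\<close>. By nilpotency some \<open>Z\<close> outside \<open>a\<close> is central
  modulo \<open>a\<close>. For such \<open>Z\<close> the integrability condition says that \<open>N = ad (J Z)\<close> commutes with \<open>J\<close>
  modulo \<open>a\<close>; stability makes \<open>N\<close> nonzero modulo \<open>a\<close>, and nilpotency keeps its nonzero values out of
  the complex line of \<open>Z\<close>. So there are \<open>E1\<close> and \<open>E2 = N E1 / 2\<close> such that \<open>E1\<close>, \<open>E2\<close>,
  \<open>E3 = J Z\<close> are complex linearly independent modulo \<open>a\<close>. In real dimension 8 this leaves exactly
  one complex line for \<open>a\<close>, which is therefore the first term of the series, hence central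
  (\<open>ex_adapted_vectors\<close>, \<open>ex_adapted_coframe\<close>).

  Modulo \<open>a\<close> the brackets are now rigid. The Leibniz rule for \<open>N\<close>, the integrability condition and
  repeated use of nilpotency determine all of them up to one bracket \<open>[E1, J E1]\<close> and one nonzero real
  number (\<open>structure_mod_stable_ideal\<close>); a change of basis gives the first three structure equations with
  \<open>\<epsilon> \<in> {0, 1}\<close> and \<open>\<delta> = 1\<close> or \<open>\<delta> = -1\<close> (\<open>ex_normalized_base\<close>).

  Since \<open>a\<close> is central and the complex structure is integrable, the differential of \<open>\<omega>\<^sup>4\<close> is a form of
  type \<open>(2,0) + (1,1)\<close> in the first three basis forms (\<open>type_decomposition\<close>). The Jacobi identity says
  that it is closed; up to differentials of \<open>\<omega>\<^sup>2\<close> and \<open>\<omega>\<^sup>3\<close> the closed ones are exactly the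
  three-parameter family of the fourth equation, with complex \<open>\<nu>\<close>, \<open>a\<close>, \<open>B\<close>
  (\<open>closed_coefficients\<close>, \<open>ex_full_eqs\<close>).

  What remains is the action of the changes of basis that preserve the shape of the equations. On the
  parameters each of them acts like \<open>\<omega>\<^sup>1 \<mapsto> u \<omega>\<^sup>1\<close>, \<open>\<omega>\<^sup>2 \<mapsto> u r \<omega>\<^sup>2\<close>, \<open>\<omega>\<^sup>3 \<mapsto> r \<omega>\<^sup>3\<close>, \<open>\<omega>\<^sup>4 \<mapsto> \<kappa> \<omega>\<^sup>4\<close>
  with \<open>u\<close> of modulus 1, \<open>r\<close> real and \<open>\<kappa>\<close> complex, both nonzero, and \<open>r = 1\<close> if \<open>\<epsilon> = 1\<close>
  (\<open>full_eqs_rescale\<close>, \<open>change_of_coframe\<close>); it sends \<open>(\<nu>, a, B)\<close> to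
  \<open>(\<kappa> \<nu> / (u r\<^sup>2), \<kappa> a / (u\<^sup>2 r), \<kappa> B)\<close>. The admissible tuples meet every orbit of this action
  (\<open>normalize_parameters\<close>) exactly once (\<open>normal_form_unique\<close>), which gives existence and
  inequivalence. Conversely, the structure equations themselves define a bracket, and the Jacobi
  identity, integrability, nilpotency and the compatible series can be read off from them
  (locale \<open>full_eqs_algebra\<close>).
\<close>

section \<open>Coframes of (1,0)-forms\<close>

lemma real_linear_inj_imp_surj:
  fixes f :: "'a::real_vector \<Rightarrow> 'b::real_vector"
  assumes "linear f" and inj: "inj f"
    and dims: "dim (UNIV :: 'a set) = dim (UNIV :: 'b set)" and pos: "dim (UNIV :: 'a set) > 0"
  shows "surj f"
proof -
  obtain A where A: "independent A" "(UNIV :: 'a set) \<subseteq> span A" "card A = dim (UNIV :: 'a set)"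
    using basis_exists[of "UNIV :: 'a set"] by metis
  obtain B where B: "independent B" "(UNIV :: 'b set) \<subseteq> span B" "card B = dim (UNIV :: 'b set)"
    using basis_exists[of "UNIV :: 'b set"] by metis
  have fin: "finite A" "finite B"
    using A(3) B(3) dims pos by (auto intro: card_ge_0_finite)
  interpret va: finite_dimensional_vector_space "scaleR :: real \<Rightarrow> 'a \<Rightarrow> 'a" A
    using A fin by unfold_locales (auto simp: dependent_raw_def[symmetric] span_raw_def[symmetric] algebra_simps)
  interpret vb: finite_dimensional_vector_space "scaleR :: real \<Rightarrow> 'b \<Rightarrow> 'b" B
    using B fin by unfold_locales (auto simp: dependent_raw_def[symmetric] span_raw_def[symmetric] algebra_simps)
  interpret vp: finite_dimensional_vector_space_pair
    "scaleR :: real \<Rightarrow> 'a \<Rightarrow> 'a" A "scaleR :: real \<Rightarrow> 'b \<Rightarrow> 'b" B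
    by unfold_locales
  show ?thesis
    by (rule vp.linear_injective_imp_surjective)
       (use assms in \<open>simp_all add: linear_def dim_raw_def[symmetric]\<close>)
qed

text \<open>
  Multiplication by a complex number when \<open>J\<close> plays the role of the imaginary unit.
\<close>

definition cscale :: "('a::real_vector \<Rightarrow> 'a) \<Rightarrow> complex \<Rightarrow> 'a \<Rightarrow> 'a" where
  "cscale J c X = Re c *\<^sub>R X + Im c *\<^sub>R J X"

lemma forms_1_0_apply:
  assumes "\<alpha> \<in> forms_1_0 J"
  shows "\<alpha> (X + Y) = \<alpha> X + \<alpha> Y" "\<alpha> (X - Y) = \<alpha> X - \<alpha> Y" "\<alpha> (- X) = - \<alpha> X" "\<alpha> 0 = 0"
    "\<alpha> (r *\<^sub>R X) = of_real r * \<alpha> X" "\<alpha> (J X) = \<i> * \<alpha> X" "\<alpha> (cscale J c X) = c * \<alpha> X"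
proof -
  have lin: "linear \<alpha>" and J: "\<And>X. \<alpha> (J X) = \<i> * \<alpha> X"
    using assms by (auto simp: forms_1_0_def)
  show "\<alpha> (X + Y) = \<alpha> X + \<alpha> Y" "\<alpha> (X - Y) = \<alpha> X - \<alpha> Y" "\<alpha> (- X) = - \<alpha> X" "\<alpha> 0 = 0"
    "\<alpha> (r *\<^sub>R X) = of_real r * \<alpha> X" "\<alpha> (J X) = \<i> * \<alpha> X"
    using lin J
    by (simp_all add: linear_add linear_diff linear_neg linear_0 linear_scale scaleR_conv_of_real)
  have "\<alpha> (cscale J c X) = (of_real (Re c) + \<i> * of_real (Im c)) * \<alpha> X"
    using lin J
    by (simp add: cscale_def linear_add linear_scale scaleR_conv_of_real algebra_simps)
  then show "\<alpha> (cscale J c X) = c * \<alpha> X"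
    by (simp flip: complex_eq)
qed

lemma forms_1_0_scale: "\<alpha> \<in> forms_1_0 J \<Longrightarrow> (\<lambda>X. c * \<alpha> X) \<in> forms_1_0 J"
  by (auto simp: forms_1_0_def linear_iff algebra_simps)

lemma forms_1_0_add: "\<alpha> \<in> forms_1_0 J \<Longrightarrow> \<beta> \<in> forms_1_0 J \<Longrightarrow> (\<lambda>X. \<alpha> X + \<beta> X) \<in> forms_1_0 J"
  by (auto simp: forms_1_0_def linear_iff algebra_simps)

lemma subspace_forms_1_0: "forms.subspace (forms_1_0 J)"
  by (auto simp: forms.subspace_def scale_form_def forms_1_0_def linear_iff algebra_simps)

text \<open>
  Joint injectivity instead of linear independence: this form of the basis condition survives
  triangular changes of the forms and pullback along isomorphisms by pure logic. In real dimension 8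
  it is equivalent to being a basis, by \<open>coframe_imp_basis\<close> and \<open>basis_imp_coframe\<close>.
\<close>

definition coframe ::
    "('a::real_vector \<Rightarrow> 'a) \<Rightarrow> 'a form \<Rightarrow> 'a form \<Rightarrow> 'a form \<Rightarrow> 'a form \<Rightarrow> bool" where
  "coframe J w1 w2 w3 w4 \<longleftrightarrow>
     {w1, w2, w3, w4} \<subseteq> forms_1_0 J \<and>
     (\<forall>X. w1 X = 0 \<and> w2 X = 0 \<and> w3 X = 0 \<and> w4 X = 0 \<longrightarrow> X = 0)"

lemma coframe_forms:
  assumes "coframe J w1 w2 w3 w4"
  shows "w1 \<in> forms_1_0 J" "w2 \<in> forms_1_0 J" "w3 \<in> forms_1_0 J" "w4 \<in> forms_1_0 J"
  using assms by (auto simp: coframe_def)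

lemma coframe_eqI:
  assumes "coframe J w1 w2 w3 w4" "w1 X = w1 Y" "w2 X = w2 Y" "w3 X = w3 Y" "w4 X = w4 Y"
  shows "X = Y"
proof -
  note ap = coframe_forms[OF assms(1), THEN forms_1_0_apply(2)]
  have "w1 (X - Y) = 0" "w2 (X - Y) = 0" "w3 (X - Y) = 0" "w4 (X - Y) = 0"
    using assms by (simp_all add: ap)
  with assms(1) have "X - Y = 0"
    unfolding coframe_def by blast
  then show ?thesis by simp
qed

text \<open>
  The four forms embed the space into \<open>\<complex>\<^sup>4\<close>, which has the same real dimension. So vectors may be
  prescribed by their four complex coordinates; in particular dual vectors exist.
\<close>

lemma coframe_surj:
  fixes J :: "'a::real_vector \<Rightarrow> 'a"
  assumes "dim (UNIV :: 'a set) = 8" "coframe J w1 w2 w3 w4"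
  obtains X where "w1 X = z1" "w2 X = z2" "w3 X = z3" "w4 X = z4"
proof -
  let ?T = "\<lambda>X. (w1 X, w2 X, w3 X, w4 X)"
  note ap = coframe_forms[OF assms(2), THEN forms_1_0_apply(1)]
    coframe_forms[OF assms(2), THEN forms_1_0_apply(5)]
  have "linear ?T"
    by (auto simp: linear_iff ap scaleR_conv_of_real)
  moreover have "inj ?T"
    using coframe_eqI[OF assms(2)] by (auto simp: inj_on_def)
  moreover have "dim (UNIV :: (complex \<times> complex \<times> complex \<times> complex) set) = 8"
    by simp
  ultimately have "surj ?T"
    using assms(1) by (intro real_linear_inj_imp_surj) auto
  from surjD[OF this, of "(z1, z2, z3, z4)"] show ?thesis
    using that by auto
qed

lemma coframe_spans:
  fixes J :: "'a::real_vector \<Rightarrow> 'a"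
  assumes dim: "dim (UNIV :: 'a set) = 8" and cf: "coframe J w1 w2 w3 w4"
    and \<alpha>: "\<alpha> \<in> forms_1_0 J"
  obtains c1 c2 c3 c4 where "\<And>X. \<alpha> X = c1 * w1 X + c2 * w2 X + c3 * w3 X + c4 * w4 X"
proof -
  obtain e1 where e1: "w1 e1 = 1" "w2 e1 = 0" "w3 e1 = 0" "w4 e1 = 0" by (rule coframe_surj[OF dim cf])
  obtain e2 where e2: "w1 e2 = 0" "w2 e2 = 1" "w3 e2 = 0" "w4 e2 = 0" by (rule coframe_surj[OF dim cf])
  obtain e3 where e3: "w1 e3 = 0" "w2 e3 = 0" "w3 e3 = 1" "w4 e3 = 0" by (rule coframe_surj[OF dim cf])
  obtain e4 where e4: "w1 e4 = 0" "w2 e4 = 0" "w3 e4 = 0" "w4 e4 = 1" by (rule coframe_surj[OF dim cf])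
  note ap = coframe_forms[OF cf, THEN forms_1_0_apply(1)] coframe_forms[OF cf, THEN forms_1_0_apply(7)]
    forms_1_0_apply(1,7)[OF \<alpha>]
  have X: "X = cscale J (w1 X) e1 + cscale J (w2 X) e2 + cscale J (w3 X) e3 + cscale J (w4 X) e4" for X
    by (rule coframe_eqI[OF cf]) (simp_all add: ap e1 e2 e3 e4)
  have "\<alpha> X = \<alpha> e1 * w1 X + \<alpha> e2 * w2 X + \<alpha> e3 * w3 X + \<alpha> e4 * w4 X" for X
    by (subst X) (simp add: ap)
  then show ?thesis by (rule that)
qed

lemma coframe_imp_basis:
  fixes J :: "'a::real_vector \<Rightarrow> 'a"
  assumes dim: "dim (UNIV :: 'a set) = 8" and cf: "coframe J (\<omega> 1) (\<omega> 2) (\<omega> 3) (\<omega> 4)"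
  shows "basis_1_0 J 4 \<omega>"
proof -
  have set4: "{1..4::nat} = {1, 2, 3, 4}" by auto
  have dual: "\<exists>e. \<forall>j\<in>{1..4}. \<omega> j e = of_bool (j = k)" if "k \<in> {1..4}" for k
    by (rule coframe_surj[OF dim cf, of "of_bool (1 = k)" "of_bool (2 = k)" "of_bool (3 = k)" "of_bool (4 = k)"])
       (unfold set4, blast)
  then obtain e where e: "\<And>j k. j \<in> {1..4} \<Longrightarrow> k \<in> {1..4} \<Longrightarrow> \<omega> j (e k) = of_bool (j = k)"
    by metis
  have inj: "inj_on \<omega> {1..4}"
  proof (rule inj_onI)
    fix j k :: nat assume jk: "j \<in> {1..4}" "k \<in> {1..4}" "\<omega> j = \<omega> k"
    then have "of_bool (j = k) = (1 :: complex)"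
      using e[of j k] e[of k k] by simp
    then show "j = k" by simp
  qed
  have "forms.independent (\<omega> ` {1..4})"
  proof (rule forms.independent_if_scalars_zero)
    fix f \<alpha> assume 0: "(\<Sum>\<alpha>\<in>\<omega> ` {1..4}. scale_form (f \<alpha>) \<alpha>) = 0" and "\<alpha> \<in> \<omega> ` {1..4}"
    then obtain k where k: "k \<in> {1..4}" "\<alpha> = \<omega> k" by auto
    have "(\<Sum>j\<in>{1..4}. scale_form (f (\<omega> j)) (\<omega> j)) (e k) = 0"
      using 0 inj by (simp add: sum.reindex)
    then have "(\<Sum>j\<in>{1..4}. f (\<omega> j) * \<omega> j (e k)) = 0"
      unfolding set4 by (simp add: scale_form_def)
    moreover have "(\<Sum>j\<in>{1..4}. f (\<omega> j) * \<omega> j (e k)) = (\<Sum>j\<in>{1..4}. if j = k then f (\<omega> j) else 0)"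
      using k(1) by (intro sum.cong) (simp_all only: e of_bool_def, simp_all)
    ultimately show "f \<alpha> = 0"
      using k by (simp add: sum.delta)
  qed simp
  moreover have "forms.span (\<omega> ` {1..4}) = forms_1_0 J"
  proof
    show "forms.span (\<omega> ` {1..4}) \<subseteq> forms_1_0 J"
      by (rule forms.span_minimal) (unfold set4, use coframe_forms[OF cf] in \<open>auto simp: subspace_forms_1_0\<close>)
    show "forms_1_0 J \<subseteq> forms.span (\<omega> ` {1..4})"
    proof
      fix \<alpha> assume "\<alpha> \<in> forms_1_0 J"
      then obtain c1 c2 c3 c4
        where "\<And>X. \<alpha> X = c1 * \<omega> 1 X + c2 * \<omega> 2 X + c3 * \<omega> 3 X + c4 * \<omega> 4 X"
        using coframe_spans[OF dim cf] by metis
      then have "\<alpha> = scale_form c1 (\<omega> 1) + scale_form c2 (\<omega> 2) + scale_form c3 (\<omega> 3) + scale_form c4 (\<omega> 4)"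
        by (auto simp: fun_eq_iff scale_form_def)
      also have "\<dots> \<in> forms.span (\<omega> ` {1..4})"
        unfolding set4 by (intro forms.span_add forms.span_scale forms.span_base) auto
      finally show "\<alpha> \<in> forms.span (\<omega> ` {1..4})" .
    qed
  qed
  ultimately show ?thesis
    using inj by (simp add: basis_1_0_def)
qed

text \<open>
  The (1,0)-forms separate points: a real functional \<open>\<phi>\<close> with \<open>\<phi> X = 1\<close> yields the (1,0)-form
  \<open>\<phi> - \<i> (\<phi> \<circ> J)\<close>, whose value at \<open>X\<close> has real part 1.
\<close>

lemma basis_imp_coframe:
  fixes J :: "'a::real_vector \<Rightarrow> 'a"
  assumes J: "linear J" "\<And>X. J (J X) = - X" and basis: "basis_1_0 J 4 \<omega>"
  shows "coframe J (\<omega> 1) (\<omega> 2) (\<omega> 3) (\<omega> 4)"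
  unfolding coframe_def
proof (intro conjI allI impI)
  have span: "forms.span (\<omega> ` {1..4}) = forms_1_0 J"
    using basis by (simp add: basis_1_0_def)
  have "\<omega> k \<in> forms_1_0 J" if "k \<in> {1..4}" for k
    using that forms.span_base[of "\<omega> k" "\<omega> ` {1..4}"] span by auto
  then show "{\<omega> 1, \<omega> 2, \<omega> 3, \<omega> 4} \<subseteq> forms_1_0 J" by auto
  fix X assume X: "\<omega> 1 X = 0 \<and> \<omega> 2 X = 0 \<and> \<omega> 3 X = 0 \<and> \<omega> 4 X = 0"
  have "\<omega> ` {1..4} \<subseteq> {\<alpha>. \<alpha> X = 0}"
  proof safe
    fix k :: nat assume "k \<in> {1..4}"
    then have "k = 1 \<or> k = 2 \<or> k = 3 \<or> k = 4" by auto
    then show "\<omega> k X = 0" using X by auto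
  qed
  then have "forms.span (\<omega> ` {1..4}) \<subseteq> {\<alpha>. \<alpha> X = 0}"
    by (rule forms.span_minimal) (auto simp: forms.subspace_def scale_form_def)
  then have van: "\<alpha> X = 0" if "\<alpha> \<in> forms_1_0 J" for \<alpha>
    using that span by auto
  show "X = 0"
  proof (rule ccontr)
    assume "X \<noteq> 0"
    then have "independent {X}" by simp
    then obtain \<phi> :: "'a \<Rightarrow> real" where \<phi>: "linear \<phi>" "\<phi> X = 1"
      using linear_independent_extend[of "{X}" "\<lambda>_. 1"] by auto
    have "(\<lambda>Y. complex_of_real (\<phi> Y) - \<i> * of_real (\<phi> (J Y))) \<in> forms_1_0 J"
      using \<phi>(1) J
      by (auto simp: forms_1_0_def linear_iff linear_neg algebra_simps scaleR_conv_of_real)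
    from van[OF this] have "complex_of_real (\<phi> X) = \<i> * of_real (\<phi> (J X))"
      by simp
    then show False
      using \<phi>(2) by (simp add: complex_eq_iff)
  qed
qed

section \<open>Nilpotent Lie algebras with a complex structure\<close>

locale almost_complex =
  fixes J :: "'a::real_vector \<Rightarrow> 'a"
  assumes linear_J: "linear J" and J_sq [simp]: "J (J X) = - X"
begin

lemma J_simps [simp]: "J (X + Y) = J X + J Y" "J (X - Y) = J X - J Y" "J (- X) = - J X"
    "J (r *\<^sub>R X) = r *\<^sub>R J X" "J 0 = 0"
  using linear_J by (simp_all add: linear_add linear_diff linear_neg linear_scale linear_0)

lemma cscale_simps:
  "cscale J c (X + Y) = cscale J c X + cscale J c Y"
  "cscale J (c + d) X = cscale J c X + cscale J d X"
  "cscale J c (cscale J d X) = cscale J (c * d) X"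
  "cscale J (of_real r) X = r *\<^sub>R X" "cscale J 1 X = X" "cscale J 0 X = 0" "cscale J c 0 = 0"
  "cscale J (- c) X = - cscale J c X"
  "J (cscale J c X) = cscale J (\<i> * c) X"
  by (simp_all add: cscale_def algebra_simps)

end

locale nilpotent_cplx =
  fixes br :: "'a::real_vector \<Rightarrow> 'a \<Rightarrow> 'a" and J :: "'a \<Rightarrow> 'a"
  assumes nil: "nilpotent_lie_algebra br" and cpx: "complex_structure br J"
begin

sublocale almost_complex J
  using cpx by (intro almost_complex.intro) (auto simp: complex_structure_def)

lemma bilinear_br: "bilinear br"
  using nil by (simp add: nilpotent_lie_algebra_def lie_algebra_def)

lemmas br_simps [simp] = bilinear_ladd[OF bilinear_br] bilinear_radd[OF bilinear_br]
  bilinear_lsub[OF bilinear_br] bilinear_rsub[OF bilinear_br]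
  bilinear_lneg[OF bilinear_br] bilinear_rneg[OF bilinear_br]
  bilinear_lmul[OF bilinear_br] bilinear_rmul[OF bilinear_br]
  bilinear_lzero[OF bilinear_br] bilinear_rzero[OF bilinear_br]

lemma br_self [simp]: "br X X = 0"
  using nil by (simp add: nilpotent_lie_algebra_def lie_algebra_def)

lemma br_skew: "br X Y = - br Y X"
proof -
  have "br (X + Y) (X + Y) = br X X + br X Y + (br Y X + br Y Y)"
    by (simp only: br_simps add_ac)
  then show ?thesis by (simp only: br_self) (simp add: eq_neg_iff_add_eq_0)
qed

lemma jacobi: "br X (br Y Z) + br Y (br Z X) + br Z (br X Y) = 0"
  using nil by (simp add: nilpotent_lie_algebra_def lie_algebra_def)

lemma br_derivation: "br X (br Y Z) = br (br X Y) Z + br Y (br X Z)"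
  using jacobi[of X Y Z] br_skew[of Z X] br_skew[of Z "br X Y"]
  by (simp add: algebra_simps)

lemma nijenhuis: "br (J X) (J Y) = br X Y + J (br (J X) Y) + J (br X (J Y))"
  using cpx by (simp add: complex_structure_def)

text \<open>
  The form in which nilpotency is used to exclude brackets: a set in which one can always move on
  by some bracket meets every term of the lower central series, so it contains 0. Any structure
  constant that would let a nonzero set of vectors reproduce itself must vanish.
\<close>

lemma bracket_escape:
  assumes "V \<noteq> {}" "\<And>v. v \<in> V \<Longrightarrow> \<exists>X. br X v \<in> V"
  shows "0 \<in> V"
proof -
  have "\<exists>v\<in>V. v \<in> lower_central br k" for k
  proof (induction k)
    case 0
    then show ?case using assms(1) by auto
  next
    case (Suc k)
    then obtain v where v: "v \<in> V" "v \<in> lower_central br k" by auto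
    then obtain X where "br X v \<in> V" using assms(2) by blast
    with v show ?case by (auto intro!: bexI[of _ "br X v"] span_base)
  qed
  moreover obtain k where "lower_central br k = {0}"
    using nil by (auto simp: nilpotent_lie_algebra_def)
  ultimately show ?thesis by (metis singletonD)
qed

text \<open>
  The dual tool: if \<open>S\<close> is generated by its own brackets up to an ideal \<open>I\<close>, then iterating shows
  that \<open>S\<close> lies in every term of the lower central series up to \<open>I\<close>, hence in \<open>I\<close>.
\<close>

lemma bracket_absorb:
  assumes I: "subspace I" "\<And>X x. x \<in> I \<Longrightarrow> br X x \<in> I"
    and S: "\<And>s. s \<in> S \<Longrightarrow> s \<in> span ({br X v | X v. v \<in> S} \<union> I)"
  shows "S \<subseteq> I"
proof -
  have lin: "linear (br X)" for X
    using bilinear_br by (simp add: bilinear_def)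
  have "S \<subseteq> span (lower_central br k \<union> I)" for k
  proof (induction k)
    case 0
    then show ?case by simp
  next
    case (Suc k)
    let ?L = "span (lower_central br (Suc k) \<union> I)"
    have "br X ` (lower_central br k \<union> I) \<subseteq> ?L" for X
      by (auto intro!: span_base I)
    then have "br X ` span (lower_central br k \<union> I) \<subseteq> ?L" for X
      by (metis linear_span_image lin span_minimal subspace_span)
    then have "{br X v | X v. v \<in> S} \<union> I \<subseteq> ?L"
      using Suc by (auto intro: span_base)
    then show ?case
      using S by (meson span_minimal subspace_span subset_eq)
  qed
  moreover obtain k where "lower_central br k = {0}"
    using nil by (auto simp: nilpotent_lie_algebra_def)
  ultimately have "S \<subseteq> span ({0} \<union> I)" by metis
  then show ?thesis
    using I(1) by (metis insert_absorb insert_is_Un span_eq_iff subspace_0)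
qed

lemma compat_subspace: "subspace (compat_series br J k)"
  by (induction k) (auto simp: subspace_def)

lemma compat_J: "X \<in> compat_series br J k \<Longrightarrow> J X \<in> compat_series br J k"
  by (cases k) (auto intro: subspace_neg[OF compat_subspace])

lemma compat_mono_Suc: "compat_series br J k \<subseteq> compat_series br J (Suc k)"
proof (induction k)
  case 0
  then show ?case by auto
next
  case (Suc k)
  then show ?case by (subst (1 2) compat_series.simps(2)) blast
qed

lemma compat_ideal: "X \<in> compat_series br J k \<Longrightarrow> br X Y \<in> compat_series br J k"
  using compat_mono_Suc by (cases k) auto

lemma compat_cscale: "X \<in> compat_series br J k \<Longrightarrow> cscale J c X \<in> compat_series br J k"
  unfolding cscale_def using compat_subspace compat_J
  by (meson subspace_add subspace_scale)

end

section \<open>Vectors adapted to a weakly non-nilpotent structure\<close>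

text \<open>
  The stable ideal \<open>a\<close> of the compatible series appears as the common kernel of \<open>w1\<close>, \<open>w2\<close>, \<open>w3\<close>.
  It is central (assumption \<open>central\<close>), it is stable (assumption \<open>stable\<close>), \<open>J e3\<close> is central modulo it,
  and \<open>ad e3\<close> sends \<open>e1\<close> to \<open>2 e2\<close> and kills \<open>e2\<close> and \<open>e3\<close> modulo it. The factor 2 matches
  \<open>wedge w1 w3 + wedge w1 (conj_form w3)\<close> at \<open>(e1, e3)\<close>.
\<close>

locale adapted_coframe = nilpotent_cplx br J
  for br :: "'a::real_vector \<Rightarrow> 'a \<Rightarrow> 'a" and J :: "'a \<Rightarrow> 'a" +
  fixes w1 w2 w3 w4 :: "'a form" and e1 e2 e3 :: 'a
  assumes cf: "coframe J w1 w2 w3 w4"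
    and dual: "w1 e1 = 1" "w2 e1 = 0" "w3 e1 = 0" "w1 e2 = 0" "w2 e2 = 1" "w3 e2 = 0"
      "w1 e3 = 0" "w2 e3 = 0" "w3 e3 = 1"
    and central: "\<And>X Y. w1 X = 0 \<Longrightarrow> w2 X = 0 \<Longrightarrow> w3 X = 0 \<Longrightarrow> br X Y = 0"
    and stable: "\<And>X. (\<And>Y. w1 (br X Y) = 0 \<and> w2 (br X Y) = 0 \<and> w3 (br X Y) = 0) \<Longrightarrow>
      (\<And>Y. w1 (br (J X) Y) = 0 \<and> w2 (br (J X) Y) = 0 \<and> w3 (br (J X) Y) = 0) \<Longrightarrow>
      w1 X = 0 \<and> w2 X = 0 \<and> w3 X = 0"
    and ad_Je3: "w1 (br (J e3) Y) = 0" "w2 (br (J e3) Y) = 0" "w3 (br (J e3) Y) = 0"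
    and ad_e3: "w1 (br e3 Y) = 0" "w2 (br e3 Y) = 2 * w1 Y" "w3 (br e3 Y) = 0"

lemma (in almost_complex) coframe_of_vectors:
  assumes dim: "dim (UNIV :: 'a set) = 8"
    and indep: "\<And>c1 c2 c3 c4. cscale J c1 E1 + cscale J c2 E2 + cscale J c3 E3 + cscale J c4 E4 = 0 \<Longrightarrow>
      c1 = 0 \<and> c2 = 0 \<and> c3 = 0 \<and> c4 = 0"
  obtains w1 w2 w3 w4 where "coframe J w1 w2 w3 w4"
    "\<And>X. X = cscale J (w1 X) E1 + cscale J (w2 X) E2 + cscale J (w3 X) E3 + cscale J (w4 X) E4"
    "\<And>c1 c2 c3 c4 X. X = cscale J c1 E1 + cscale J c2 E2 + cscale J c3 E3 + cscale J c4 E4 \<Longrightarrow>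
      w1 X = c1 \<and> w2 X = c2 \<and> w3 X = c3 \<and> w4 X = c4"
proof -
  define T where "T = (\<lambda>(c1, c2, c3, c4).
    cscale J c1 E1 + cscale J c2 E2 + cscale J c3 E3 + cscale J c4 E4)"
  have lin: "linear T"
  proof (rule linearI)
    have "cscale J (r *\<^sub>R c) X = r *\<^sub>R cscale J c X" for r c X
      by (simp add: cscale_def scaleR_right_distrib)
    then show "T (r *\<^sub>R z) = r *\<^sub>R T z" for r z
      by (simp add: T_def split_beta scaleR_right_distrib)
    show "T (x + y) = T x + T y" for x y
      by (simp only: T_def split_beta fst_add snd_add cscale_simps(2) add_ac)
  qed
  have inj: "inj T"
  proof -
    have "z = 0" if "T z = 0" for z
    proof (cases z)
      case (fields c1 c2 c3 c4)
      then show ?thesis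
        using that indep[of c1 c2 c3 c4] by (simp add: T_def zero_prod_def)
    qed
    then show ?thesis by (simp add: linear_injective_0[OF lin])
  qed
  have dimC: "dim (UNIV :: (complex \<times> complex \<times> complex \<times> complex) set) = 8"
    by simp
  have "surj T"
    using real_linear_inj_imp_surj[OF lin inj] dim dimC by simp
  obtain g where g: "linear g" "g \<circ> T = id"
    using linear_injective_left_inverse[OF lin inj] by auto
  have gT: "g (T z) = z" for z
    using g(2) by (metis comp_apply id_apply)
  have Tg: "T (g X) = X" for X
    using \<open>surj T\<close> gT by (metis surjD)
  define w1 where "w1 = (\<lambda>X. fst (g X))"
  define w2 where "w2 = (\<lambda>X. fst (snd (g X)))"
  define w3 where "w3 = (\<lambda>X. fst (snd (snd (g X))))"
  define w4 where "w4 = (\<lambda>X. snd (snd (snd (g X))))"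
  have gw: "g X = (w1 X, w2 X, w3 X, w4 X)" for X
    by (simp add: w1_def w2_def w3_def w4_def)
  have X: "X = cscale J (w1 X) E1 + cscale J (w2 X) E2 + cscale J (w3 X) E3 + cscale J (w4 X) E4" for X
    using Tg[of X] by (simp add: gw T_def)
  have w: "w1 X = c1 \<and> w2 X = c2 \<and> w3 X = c3 \<and> w4 X = c4"
    if "X = cscale J c1 E1 + cscale J c2 E2 + cscale J c3 E3 + cscale J c4 E4" for X c1 c2 c3 c4
    using gT[of "(c1, c2, c3, c4)"] that by (simp add: gw T_def)
  have "J X = cscale J (\<i> * w1 X) E1 + cscale J (\<i> * w2 X) E2
      + cscale J (\<i> * w3 X) E3 + cscale J (\<i> * w4 X) E4" for X
    by (subst X) (simp only: J_simps cscale_simps)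
  note wJ = w[OF this]
  have "w1 \<in> forms_1_0 J" "w2 \<in> forms_1_0 J" "w3 \<in> forms_1_0 J" "w4 \<in> forms_1_0 J"
    using wJ g(1)
    by (auto simp: forms_1_0_def linear_iff w1_def w2_def w3_def w4_def)
  moreover have "X = 0" if "w1 X = 0" "w2 X = 0" "w3 X = 0" "w4 X = 0" for X
    by (subst X) (simp add: that cscale_simps)
  ultimately have "coframe J w1 w2 w3 w4"
    by (auto simp: coframe_def)
  then show ?thesis
    by (rule that[OF _ X w])
qed

text \<open>
  The heart of the classification, for any proper stable ideal \<open>a\<close>. A vector \<open>Z\<close> outside \<open>a\<close> but
  central modulo \<open>a\<close> exists by nilpotency, and \<open>ad (J Z)\<close> is complex linear modulo \<open>a\<close> by
  integrability. The other conclusions express its nilpotency: no value of \<open>ad E3\<close> is congruent to a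
  nonzero complex multiple of \<open>E3\<close>, and \<open>E1\<close> is not congruent to a combination of \<open>E2\<close> and \<open>E3\<close>.
\<close>

lemma (in nilpotent_cplx) ex_adapted_vectors:
  assumes a: "subspace a" "\<And>X. X \<in> a \<Longrightarrow> J X \<in> a" "\<And>X Y. X \<in> a \<Longrightarrow> br X Y \<in> a"
      "\<And>X. (\<And>Y. br X Y \<in> a) \<Longrightarrow> (\<And>Y. br (J X) Y \<in> a) \<Longrightarrow> X \<in> a"
    and proper: "a \<noteq> UNIV"
  obtains E3 E1 E2 where
    "\<And>Y. br (J E3) Y \<in> a" "\<And>c Y. br E3 (cscale J c Y) - cscale J c (br E3 Y) \<in> a"
    "br E3 E1 = 2 *\<^sub>R E2"
    "\<And>c Y. br E3 Y - cscale J c E3 \<in> a \<Longrightarrow> c = 0"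
    "\<And>c1 c2 c3. cscale J c1 E1 + cscale J c2 E2 + cscale J c3 E3 \<in> a \<Longrightarrow> c1 = 0 \<and> c2 = 0 \<and> c3 = 0"
proof -
  note sub = subspace_0[OF a(1)] subspace_add[OF a(1)] subspace_diff[OF a(1)] subspace_scale[OF a(1)]
    subspace_neg[OF a(1)] 
  have a_cscale: "cscale J c X \<in> a" if "X \<in> a" for c X
    using that unfolding cscale_def by (intro sub a(2))
  have a_cscale_iff: "X \<in> a" if "cscale J c X \<in> a" "c \<noteq> 0" for c X
    using a_cscale[OF that(1), of "1 / c"] that(2) by (simp add: cscale_simps)
  have a_ideal': "br Y X \<in> a" if "X \<in> a" for X Y
    using sub(5)[OF a(3)[OF that, of Y]] br_skew[of Y X] by simp
  have "\<exists>Z. Z \<notin> a \<and> (\<forall>Y. br Y Z \<in> a)"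
    using bracket_escape[of "- a"] proper sub(1) by auto
  then obtain Z where Z: "Z \<notin> a" "\<And>Y. br Y Z \<in> a" by blast
  have Z': "br Z Y \<in> a" for Y
    using sub(5)[OF Z(2)[of Y]] br_skew[of Z Y] by simp
  define E3 where "E3 = J Z"
  have JE3: "J E3 = - Z" by (simp add: E3_def)
  have E3: "E3 \<notin> a" using Z(1) a(2)[of E3] sub(5)[of "- Z"] by (auto simp: JE3)
  have ad_JE3: "br (J E3) Y \<in> a" for Y
    using sub(5)[OF Z'] by (simp add: JE3)
  have ad_E3_J: "br E3 (J Y) - J (br E3 Y) \<in> a" for Y
  proof -
    have "br E3 (J Y) - J (br E3 Y) = br Z Y + J (br Z (J Y))"
      using nijenhuis[of Z Y] by (simp add: E3_def)
    then show ?thesis using sub a(2) Z' by simp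
  qed
  have ad_E3_c: "br E3 (cscale J c Y) - cscale J c (br E3 Y) \<in> a" for c Y
  proof -
    have "br E3 (cscale J c Y) - cscale J c (br E3 Y) = Im c *\<^sub>R (br E3 (J Y) - J (br E3 Y))"
      by (simp add: cscale_def algebra_simps)
    then show ?thesis using sub(4) ad_E3_J by simp
  qed
  have no_E3: "c = 0" if Y: "br E3 Y - cscale J c E3 \<in> a" for c Y
  proof (rule ccontr)
    assume c: "c \<noteq> 0"
    \<comment> \<open>The rotated vector makes the multiple of \<open>E3\<close> real and positive, so that \<open>ad Y'\<close> has an eigenvector modulo \<open>a\<close> and \<open>J E3\<close>.\<close>
    define Y' where "Y' = cscale J (cnj c) Y"
    have "(br E3 Y' - cscale J (cnj c) (br E3 Y)) + cscale J (cnj c) (br E3 Y - cscale J c E3) \<in> a"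
      unfolding Y'_def by (intro sub(2) ad_E3_c a_cscale Y)
    also have "(br E3 Y' - cscale J (cnj c) (br E3 Y)) + cscale J (cnj c) (br E3 Y - cscale J c E3)
        = br E3 Y' - cscale J (cnj c * c) E3"
      by (simp add: cscale_def algebra_simps)
    also have "cnj c * c = of_real ((cmod c)\<^sup>2)"
      by (simp only: complex_norm_square mult.commute)
    finally have A: "br E3 Y' - (cmod c)\<^sup>2 *\<^sub>R E3 \<in> a"
      by (simp only: cscale_simps)
    define V where "V = {v. \<exists>s r. s \<noteq> 0 \<and> v - (s *\<^sub>R E3 + r *\<^sub>R J E3) \<in> a}"
    have VI: "v \<in> V" if "s \<noteq> 0" "v - (s *\<^sub>R E3 + r *\<^sub>R J E3) \<in> a" for v s r
      unfolding V_def using that by (intro CollectI exI conjI)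
    have "E3 \<in> V"
      by (rule VI[of 1 _ 0]) (simp_all add: sub(1))
    moreover have "\<exists>X. br X v \<in> V" if "v \<in> V" for v
    proof -
      from that obtain s r where s: "s \<noteq> 0" "v - (s *\<^sub>R E3 + r *\<^sub>R J E3) \<in> a"
        by (auto simp: V_def)
      have "br Y' (v - (s *\<^sub>R E3 + r *\<^sub>R J E3)) + r *\<^sub>R br Y' (J E3) - s *\<^sub>R (br E3 Y' - (cmod c)\<^sup>2 *\<^sub>R E3) \<in> a"
        by (rule sub(3)[OF sub(2)[OF a_ideal'[OF s(2)] sub(4)] sub(4)[OF A]])
           (simp add: JE3 sub(5) Z(2))
      also have "br Y' (v - (s *\<^sub>R E3 + r *\<^sub>R J E3)) + r *\<^sub>R br Y' (J E3) - s *\<^sub>R (br E3 Y' - (cmod c)\<^sup>2 *\<^sub>R E3)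
          = br Y' v - (- s * (cmod c)\<^sup>2) *\<^sub>R E3"
        using br_skew[of E3 Y'] by (simp add: algebra_simps)
      finally have "br Y' v \<in> V"
        using s(1) c by (intro VI[of "- s * (cmod c)\<^sup>2" _ 0]) simp_all
      then show ?thesis ..
    qed
    ultimately have "0 \<in> V" by (intro bracket_escape) auto
    then obtain s r where s: "s \<noteq> 0" "- (s *\<^sub>R E3 + r *\<^sub>R J E3) \<in> a"
      by (auto simp: V_def)
    from sub(5)[OF s(2)] have "cscale J (Complex s r) E3 \<in> a"
      by (simp add: cscale_def add.commute)
    moreover have "Complex s r \<noteq> 0"
      using s(1) by (simp add: complex_eq_iff)
    ultimately have "E3 \<in> a"
      by (rule a_cscale_iff)
    with E3 show False ..
  qed
  have "\<exists>E1. br E3 E1 \<notin> a"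
    using a(4)[of E3] E3 ad_JE3 by blast
  then obtain E1 where E1: "br E3 E1 \<notin> a" by blast
  define E2 where "E2 = (1/2) *\<^sub>R br E3 E1"
  have brE1: "br E3 E1 = 2 *\<^sub>R E2" by (simp add: E2_def)
  have E2: "E2 \<notin> a" using E1 sub(4)[of E2 2] by (auto simp: brE1)
  \<comment> \<open>If \<open>E1\<close> were a combination of \<open>E2\<close> and \<open>E3\<close>, applying \<open>ad E3\<close> would make \<open>E2\<close> an eigenvector of it with nonzero eigenvalue.\<close>
  have c1: "c1 = 0" if A: "cscale J c1 E1 + cscale J c2 E2 + cscale J c3 E3 \<in> a" for c1 c2 c3
  proof (rule ccontr)
    assume c1: "c1 \<noteq> 0"
    have N3: "br E3 (cscale J c E3) \<in> a" for c
      using ad_E3_c[of c E3] by (simp add: cscale_simps)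
    have "br E3 (cscale J c1 E1 + cscale J c2 E2 + cscale J c3 E3) - br E3 (cscale J c3 E3)
       - (br E3 (cscale J c1 E1) - cscale J c1 (br E3 E1))
       - (br E3 (cscale J c2 E2) - cscale J c2 (br E3 E2)) \<in> a"
      by (intro sub(3) a_ideal' A N3 ad_E3_c)
    then have B: "cscale J c1 (br E3 E1) + cscale J c2 (br E3 E2) \<in> a"
      by (simp add: algebra_simps)
    then have B': "cscale J (2 * c1) E2 + cscale J c2 (br E3 E2) \<in> a"
      by (simp add: brE1 cscale_simps cscale_def algebra_simps)
    have c2: "c2 \<noteq> 0"
      using B' a_cscale_iff[of "2 * c1" E2] c1 E2 by (auto simp: cscale_simps)
    define V where "V = {v. \<exists>k. k \<noteq> 0 \<and> v - cscale J k E2 \<in> a}"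
    have VI: "v \<in> V" if "k \<noteq> 0" "v - cscale J k E2 \<in> a" for v k
      unfolding V_def using that by (intro CollectI exI conjI)
    have "E2 \<in> V"
      by (rule VI[of 1]) (simp_all add: sub(1) cscale_simps)
    moreover have "\<exists>X. br X v \<in> V" if "v \<in> V" for v
    proof -
      from that obtain k where k: "k \<noteq> 0" "v - cscale J k E2 \<in> a" by (auto simp: V_def)
      have "br E3 (v - cscale J k E2) + (br E3 (cscale J k E2) - cscale J k (br E3 E2))
          + cscale J (k / c2) (cscale J (2 * c1) E2 + cscale J c2 (br E3 E2)) \<in> a"
        by (intro sub a_ideal' k ad_E3_c a_cscale B')
      also have "br E3 (v - cscale J k E2) + (br E3 (cscale J k E2) - cscale J k (br E3 E2))
          + cscale J (k / c2) (cscale J (2 * c1) E2 + cscale J c2 (br E3 E2))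
          = br E3 v - cscale J (- (k * (2 * c1) / c2)) E2"
        using c2 by (simp add: cscale_simps)
      finally have "br E3 v \<in> V"
        using k(1) c1 c2 by (intro VI[of "- (k * (2 * c1) / c2)"]) simp_all
      then show ?thesis ..
    qed
    ultimately have "0 \<in> V" by (intro bracket_escape) auto
    then obtain k where k: "k \<noteq> 0" "- cscale J k E2 \<in> a" by (auto simp: V_def)
    then have "E2 \<in> a" using a_cscale_iff sub(5)[OF k(2)] by simp
    with E2 show False ..
  qed
  have ind: "c1 = 0 \<and> c2 = 0 \<and> c3 = 0" if A: "cscale J c1 E1 + cscale J c2 E2 + cscale J c3 E3 \<in> a" for c1 c2 c3
  proof -
    have c1: "c1 = 0" using c1[OF A] .
    have c2: "c2 = 0"
    proof (rule ccontr)
      assume c2: "c2 \<noteq> 0"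
      have "cscale J (2 / c2) (cscale J c2 E2 + cscale J c3 E3) \<in> a"
        using A c1 by (intro a_cscale) (simp add: cscale_simps)
      also have "cscale J (2 / c2) (cscale J c2 E2 + cscale J c3 E3)
          = br E3 E1 - cscale J (- (2 * c3 / c2)) E3"
        using c2 cscale_simps(4)[of 2 E2] by (simp add: cscale_simps brE1)
      finally have *: "br E3 E1 - cscale J (- (2 * c3 / c2)) E3 \<in> a" .
      show False using * E1 unfolding no_E3[OF *] by (simp add: cscale_simps)
    qed
    have "c3 = 0"
      using A a_cscale_iff[of c3 E3] E3 c1 c2 by (auto simp: cscale_simps)
    with c1 c2 show ?thesis by simp
  qed
  show ?thesis
    by (rule that[of E3 E1 E2]) (fact ad_JE3 ad_E3_c brE1 no_E3 ind)+
qed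

text \<open>
  The three independent vectors modulo \<open>a\<close> and one nonzero vector of the first term of the series
  already span a space of real dimension 8. So \<open>a\<close> is the complex line of that vector.
\<close>

lemma (in nilpotent_cplx) ex_adapted_coframe:
  assumes dim: "dim (UNIV :: 'a set) = 8" and wnn: "weakly_non_nilpotent br J"
  obtains w1 w2 w3 w4 e1 e2 e3 where "adapted_coframe br J w1 w2 w3 w4 e1 e2 e3"
proof -
  obtain t where t: "t > 0" "\<And>l. l \<ge> 1 \<Longrightarrow> compat_series br J t = compat_series br J (t + l)"
      "compat_series br J t \<noteq> UNIV"
    using wnn by (auto simp: weakly_non_nilpotent_def)
  define a where "a = compat_series br J t"
  have sub: "subspace a" and aJ: "\<And>X. X \<in> a \<Longrightarrow> J X \<in> a" and ideal: "\<And>X Y. X \<in> a \<Longrightarrow> br X Y \<in> a"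
    and a_cscale: "\<And>X c. X \<in> a \<Longrightarrow> cscale J c X \<in> a"
    unfolding a_def by (fact compat_subspace compat_J compat_ideal compat_cscale)+
  have a_stable: "X \<in> a" if "\<And>Y. br X Y \<in> a" "\<And>Y. br (J X) Y \<in> a" for X
  proof -
    have "X \<in> compat_series br J (t + 1)"
      using that by (simp add: a_def)
    then show ?thesis using t(2)[of 1] unfolding a_def by blast
  qed
  obtain E3 E1 E2 where E:
    "\<And>Y. br (J E3) Y \<in> a" "\<And>c Y. br E3 (cscale J c Y) - cscale J c (br E3 Y) \<in> a"
    "br E3 E1 = 2 *\<^sub>R E2"
    "\<And>c Y. br E3 Y - cscale J c E3 \<in> a \<Longrightarrow> c = 0"
    "\<And>c1 c2 c3. cscale J c1 E1 + cscale J c2 E2 + cscale J c3 E3 \<in> a \<Longrightarrow> c1 = 0 \<and> c2 = 0 \<and> c3 = 0"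
  proof (rule ex_adapted_vectors[OF sub aJ ideal a_stable t(3)[folded a_def]], goal_cases)
    case (5 E3 E1 E2)
    show ?case by (rule 5(1)[OF 5(2-)])
  qed
  have "0 \<in> compat_series br J 1" by (rule subspace_0[OF compat_subspace])
  then obtain E4 where E4: "E4 \<in> compat_series br J 1" "E4 \<noteq> 0"
    using wnn by (auto simp: weakly_non_nilpotent_def)
  have "compat_series br J 1 \<subseteq> a"
    unfolding a_def using lift_Suc_mono_le[of "compat_series br J" 1 t] compat_mono_Suc t(1) by simp
  then have E4a: "cscale J c E4 \<in> a" for c
    using E4(1) a_cscale by blast
  have indep: "c1 = 0 \<and> c2 = 0 \<and> c3 = 0 \<and> c4 = 0"
    if 0: "cscale J c1 E1 + cscale J c2 E2 + cscale J c3 E3 + cscale J c4 E4 = 0" for c1 c2 c3 c4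
  proof -
    have "cscale J c1 E1 + cscale J c2 E2 + cscale J c3 E3 = - cscale J c4 E4"
      using 0 by (simp add: eq_neg_iff_add_eq_0)
    then have c: "c1 = 0 \<and> c2 = 0 \<and> c3 = 0"
      using E(5) subspace_neg[OF sub E4a] by metis
    then have *: "cscale J c4 E4 = 0" using 0 by (simp add: cscale_simps)
    have "c4 = 0"
    proof (rule ccontr)
      assume "c4 \<noteq> 0"
      then have "E4 = cscale J (1 / c4) (cscale J c4 E4)" by (simp add: cscale_simps)
      with * E4(2) show False by (simp add: cscale_simps)
    qed
    with c show ?thesis by simp
  qed
  obtain w1 w2 w3 w4 where cf: "coframe J w1 w2 w3 w4"
    and X: "\<And>X. X = cscale J (w1 X) E1 + cscale J (w2 X) E2 + cscale J (w3 X) E3 + cscale J (w4 X) E4"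
    and w: "\<And>c1 c2 c3 c4 X. X = cscale J c1 E1 + cscale J c2 E2 + cscale J c3 E3 + cscale J c4 E4 \<Longrightarrow>
      w1 X = c1 \<and> w2 X = c2 \<and> w3 X = c3 \<and> w4 X = c4"
  proof (rule coframe_of_vectors[of E1 E2 E3 E4, OF dim indep], goal_cases)
    case (2 w1 w2 w3 w4)
    show ?case by (rule 2(1)[OF 2(2-)])
  qed
  have mem_a: "X \<in> a \<longleftrightarrow> w1 X = 0 \<and> w2 X = 0 \<and> w3 X = 0" for X
  proof
    assume "X \<in> a"
    then have "X - cscale J (w4 X) E4 \<in> a"
      by (rule subspace_diff[OF sub _ E4a])
    also have "X - cscale J (w4 X) E4 = cscale J (w1 X) E1 + cscale J (w2 X) E2 + cscale J (w3 X) E3"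
      using X[of X] by (simp add: algebra_simps)
    finally show "w1 X = 0 \<and> w2 X = 0 \<and> w3 X = 0" by (rule E(5))
  next
    assume "w1 X = 0 \<and> w2 X = 0 \<and> w3 X = 0"
    then show "X \<in> a"
      by (subst X) (simp add: cscale_simps E4a)
  qed
  have dual: "w1 E1 = 1" "w2 E1 = 0" "w3 E1 = 0" "w1 E2 = 0" "w2 E2 = 1" "w3 E2 = 0"
      "w1 E3 = 0" "w2 E3 = 0" "w3 E3 = 1"
    using w[of E1 1 0 0 0] w[of E2 0 1 0 0] w[of E3 0 0 1 0] by (simp_all add: cscale_simps)
  have E4c: "br (cscale J c E4) Y = 0" for c Y
    using E4(1) by (simp add: cscale_def)
  have central: "br X Y = 0" if "w1 X = 0" "w2 X = 0" "w3 X = 0" for X Y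
    by (subst X) (simp add: that cscale_simps E4c)
  note ap = coframe_forms[OF cf, THEN forms_1_0_apply(1)] coframe_forms[OF cf, THEN forms_1_0_apply(2)]
    coframe_forms[OF cf, THEN forms_1_0_apply(5)] coframe_forms[OF cf, THEN forms_1_0_apply(7)]
  have wN: "w1 (br E3 (cscale J c Y)) = c * w1 (br E3 Y)" "w2 (br E3 (cscale J c Y)) = c * w2 (br E3 Y)"
      "w3 (br E3 (cscale J c Y)) = c * w3 (br E3 Y)" for c Y
    using E(2)[of c Y] by (simp_all add: mem_a ap)
  have NE4: "br E3 (cscale J c E4) = 0" for c
    using br_skew[of E3 "cscale J c E4"] by (simp add: E4c)
  have NE3: "br E3 (cscale J c E3) \<in> a" for c
    using E(2)[of c E3] by (simp add: cscale_simps)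
  \<comment> \<open>In the coordinates \<open>w1\<close>, \<open>w2\<close> modulo \<open>E3\<close>, \<open>ad E3\<close> is the complex matrix with rows \<open>(0, p1)\<close> and \<open>(2, p2)\<close>; nilpotency forces first its determinant and then its trace to vanish.\<close>
  define p1 p2 p3 where "p1 = w1 (br E3 E2)" and "p2 = w2 (br E3 E2)" and "p3 = w3 (br E3 E2)"
  have expand: "br E3 Y = br E3 (cscale J (w1 Y) E1) + br E3 (cscale J (w2 Y) E2)
      + br E3 (cscale J (w3 Y) E3) + br E3 (cscale J (w4 Y) E4)" for Y
    by (subst X[of Y]) (simp only: br_simps)
  have N: "w1 (br E3 Y) = w2 Y * p1" "w2 (br E3 Y) = 2 * w1 Y + w2 Y * p2" "w3 (br E3 Y) = w2 Y * p3" for Y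
    using NE3 E(3)
    by (subst expand, simp add: ap wN NE4 mem_a dual p1_def p2_def p3_def)+
  have p1: "p1 = 0"
  proof (rule ccontr)
    assume "p1 \<noteq> 0"
    have "0 \<in> {v. w1 v \<noteq> 0 \<or> w2 v \<noteq> 0}"
    proof (rule bracket_escape[rotated])
      show "{v. w1 v \<noteq> 0 \<or> w2 v \<noteq> 0} \<noteq> {}"
        using dual(1) by (metis (mono_tags, lifting) empty_iff mem_Collect_eq zero_neq_one)
    qed (use \<open>p1 \<noteq> 0\<close> in \<open>auto simp: N intro!: exI[of _ E3]\<close>)
    then show False
      using coframe_forms[OF cf, THEN forms_1_0_apply(4)] by simp
  qed
  have p2: "p2 = 0"
  proof (rule ccontr)
    assume "p2 \<noteq> 0"
    have "0 \<in> {v. w1 v = 0 \<and> w2 v \<noteq> 0}"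
    proof (rule bracket_escape[rotated])
      show "{v. w1 v = 0 \<and> w2 v \<noteq> 0} \<noteq> {}"
        using dual(4,5) by (metis (mono_tags, lifting) empty_iff mem_Collect_eq zero_neq_one)
    qed (use \<open>p2 \<noteq> 0\<close> in \<open>auto simp: N p1 intro!: exI[of _ E3]\<close>)
    then show False
      using coframe_forms[OF cf, THEN forms_1_0_apply(4)] by simp
  qed
  have p3: "p3 = 0"
    by (rule E(4)[of E2]) (simp add: mem_a ap dual N p1 p2)
  have "adapted_coframe br J w1 w2 w3 w4 E1 E2 E3"
  proof unfold_locales
    show "w1 X = 0 \<and> w2 X = 0 \<and> w3 X = 0"
      if "\<And>Y. w1 (br X Y) = 0 \<and> w2 (br X Y) = 0 \<and> w3 (br X Y) = 0"
        "\<And>Y. w1 (br (J X) Y) = 0 \<and> w2 (br (J X) Y) = 0 \<and> w3 (br (J X) Y) = 0" for X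
      using that a_stable[of X] by (simp add: mem_a)
  qed (use cf dual central E(1) in \<open>simp_all add: N p1 p2 p3 mem_a\<close>)
  then show ?thesis by (rule that)
qed

section \<open>Brackets modulo the stable ideal\<close>

lemma (in nilpotent_cplx) br_cscale_same:
  "br (cscale J b X) (cscale J c X) = Im (cnj b * c) *\<^sub>R br X (J X)"
  using br_skew[of "J X" X] by (simp add: cscale_def algebra_simps)

context adapted_coframe
begin

lemmas w_simps [simp] =
  coframe_forms(1)[OF cf, THEN forms_1_0_apply(1)] coframe_forms(1)[OF cf, THEN forms_1_0_apply(2)]
  coframe_forms(1)[OF cf, THEN forms_1_0_apply(3)] coframe_forms(1)[OF cf, THEN forms_1_0_apply(4)]
  coframe_forms(1)[OF cf, THEN forms_1_0_apply(5)] coframe_forms(1)[OF cf, THEN forms_1_0_apply(6)]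
  coframe_forms(1)[OF cf, THEN forms_1_0_apply(7)]
  coframe_forms(2)[OF cf, THEN forms_1_0_apply(1)] coframe_forms(2)[OF cf, THEN forms_1_0_apply(2)]
  coframe_forms(2)[OF cf, THEN forms_1_0_apply(3)] coframe_forms(2)[OF cf, THEN forms_1_0_apply(4)]
  coframe_forms(2)[OF cf, THEN forms_1_0_apply(5)] coframe_forms(2)[OF cf, THEN forms_1_0_apply(6)]
  coframe_forms(2)[OF cf, THEN forms_1_0_apply(7)]
  coframe_forms(3)[OF cf, THEN forms_1_0_apply(1)] coframe_forms(3)[OF cf, THEN forms_1_0_apply(2)]
  coframe_forms(3)[OF cf, THEN forms_1_0_apply(3)] coframe_forms(3)[OF cf, THEN forms_1_0_apply(4)]
  coframe_forms(3)[OF cf, THEN forms_1_0_apply(5)] coframe_forms(3)[OF cf, THEN forms_1_0_apply(6)]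
  coframe_forms(3)[OF cf, THEN forms_1_0_apply(7)]

declare dual [simp] ad_Je3 [simp] ad_e3 [simp]

lemma br_cong:
  assumes "w1 X = w1 X'" "w2 X = w2 X'" "w3 X = w3 X'"
  shows "br X Y = br X' Y" "br Y X = br Y X'"
proof -
  have "br (X - X') Y = 0"
    by (rule central) (simp_all add: assms)
  then show "br X Y = br X' Y" by simp
  then show "br Y X = br Y X'"
    using br_skew[of Y X] br_skew[of Y X'] by simp
qed

lemma ad_cscale_e3:
  "w1 (br (cscale J c e3) Y) = 0" "w2 (br (cscale J c e3) Y) = 2 * of_real (Re c) * w1 Y"
  "w3 (br (cscale J c e3) Y) = 0"
  by (simp_all add: cscale_def)

text \<open>
  Modulo the ideal \<open>ad e3\<close> is the derivation \<open>X \<mapsto> 2 w1(X) e2\<close>. Its Leibniz rule trades the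
  \<open>w1\<close>-component of any bracket for brackets with the complex line of \<open>e2\<close>.
\<close>

lemma ad_e3_leibniz:
  shows "w1 (br (cscale J (w1 X) e2) Y) + w1 (br X (cscale J (w1 Y) e2)) = 0"
    and "w2 (br (cscale J (w1 X) e2) Y) + w2 (br X (cscale J (w1 Y) e2)) = w1 (br X Y)"
    and "w3 (br (cscale J (w1 X) e2) Y) + w3 (br X (cscale J (w1 Y) e2)) = 0"
proof -
  have "br e3 (br X Y) = br (br e3 X) Y + br X (br e3 Y)"
    by (rule br_derivation)
  also have "br (br e3 X) Y = br (2 *\<^sub>R cscale J (w1 X) e2) Y"
    by (rule br_cong) simp_all
  also have "br X (br e3 Y) = br X (2 *\<^sub>R cscale J (w1 Y) e2)"
    by (rule br_cong) simp_all
  finally have *: "br (cscale J (w1 X) e2) Y + br X (cscale J (w1 Y) e2) = (1/2) *\<^sub>R br e3 (br X Y)"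
    by (simp add: scaleR_right_distrib)
  show "w1 (br (cscale J (w1 X) e2) Y) + w1 (br X (cscale J (w1 Y) e2)) = 0"
    using arg_cong[OF *, of w1] by simp
  show "w2 (br (cscale J (w1 X) e2) Y) + w2 (br X (cscale J (w1 Y) e2)) = w1 (br X Y)"
    using arg_cong[OF *, of w2] by simp
  show "w3 (br (cscale J (w1 X) e2) Y) + w3 (br X (cscale J (w1 Y) e2)) = 0"
    using arg_cong[OF *, of w3] by simp
qed

text \<open>
  By the Leibniz rule \<open>[e2, J e2]\<close> is a complex multiple \<open>c e2\<close> modulo the ideal. Then \<open>ad (\<i> c e2)\<close> has \<open>c e2\<close> as an
  eigenvector with eigenvalue \<open>- (cmod c)\<^sup>2\<close>, which nilpotency allows only for \<open>c = 0\<close>.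
\<close>

lemma br_e2_Je2: "w1 (br e2 (J e2)) = 0" "w2 (br e2 (J e2)) = 0" "w3 (br e2 (J e2)) = 0"
proof -
  show 1: "w1 (br e2 (J e2)) = 0" and 3: "w3 (br e2 (J e2)) = 0"
    using ad_e3_leibniz(1,3)[of e2 "J e1"] by (simp_all add: cscale_simps cscale_def)
  show "w2 (br e2 (J e2)) = 0"
  proof (rule ccontr)
    let ?c = "w2 (br e2 (J e2))"
    assume c: "?c \<noteq> 0"
    let ?V = "{v. w1 v = 0 \<and> w3 v = 0 \<and> (\<exists>t\<noteq>0. w2 v = of_real t * ?c)}"
    have VI: "v \<in> ?V" if "w1 v = 0" "w3 v = 0" "w2 v = of_real t * ?c" "t \<noteq> 0" for v t
      using that by blast
    have "0 \<in> ?V"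
    proof (rule bracket_escape)
      have "cscale J ?c e2 \<in> ?V"
        by (rule VI[of _ 1]) simp_all
      then show "?V \<noteq> {}" by blast
      fix v assume "v \<in> ?V"
      then obtain t where t: "w1 v = 0" "w3 v = 0" "w2 v = of_real t * ?c" "t \<noteq> 0" by blast
      have "br (cscale J (\<i> * ?c) e2) v = br (cscale J (\<i> * ?c) e2) (cscale J (of_real t * ?c) e2)"
        by (rule br_cong) (simp_all add: t)
      also have "\<dots> = Im (cnj (\<i> * ?c) * (of_real t * ?c)) *\<^sub>R br e2 (J e2)"
        by (rule br_cscale_same)
      also have "cnj (\<i> * ?c) * (of_real t * ?c) = - \<i> * (of_real t * (?c * cnj ?c))"
        by simp
      also have "\<dots> = - \<i> * of_real (t * (cmod ?c)\<^sup>2)"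
        by (simp only: complex_norm_square[symmetric] of_real_mult)
      finally have "br (cscale J (\<i> * ?c) e2) v \<in> ?V"
        using c t(4) by (intro VI[of _ "- t * (cmod ?c)\<^sup>2"]) (simp_all add: 1 3)
      then show "\<exists>X. br X v \<in> ?V" ..
    qed
    then show False using c by simp
  qed
qed

lemma br_ker_w1_e2:
  assumes "w1 X = 0"
  shows "w1 (br X (cscale J c e2)) = 0" "w2 (br X (cscale J c e2)) = 0" "w3 (br X (cscale J c e2)) = 0"
proof -
  have "br X (cscale J c e2) = br (cscale J (w2 X) e2 + cscale J (w3 X) e3) (cscale J c e2)"
    by (rule br_cong) (simp_all add: assms)
  then have *: "br X (cscale J c e2) = Im (cnj (w2 X) * c) *\<^sub>R br e2 (J e2) + br (cscale J (w3 X) e3) (cscale J c e2)"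
    by (simp add: br_cscale_same)
  show "w1 (br X (cscale J c e2)) = 0" "w2 (br X (cscale J c e2)) = 0" "w3 (br X (cscale J c e2)) = 0"
    unfolding * by (simp_all add: ad_cscale_e3 br_e2_Je2)
qed

text \<open>
  The kernel of \<open>w1\<close> is an ideal by the Leibniz rule, so only \<open>[e1, J e1] = c e1\<close> could contribute. For
  nonzero \<open>c\<close> the set \<open>w1 = c\<close> would be mapped to itself by \<open>ad X\<close>, where \<open>X\<close> is chosen such that
  the imaginary part of \<open>cnj (w1 X) * c\<close> is 1.
\<close>

lemma w1_br: "w1 (br X Y) = 0"
proof -
  have ker: "w1 (br K Y) = 0" "w1 (br Y K) = 0" if "w1 K = 0" for K Y
  proof -
    show "w1 (br K Y) = 0"
      using ad_e3_leibniz(2)[of K Y] that by (simp add: br_ker_w1_e2 cscale_simps)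
    then show "w1 (br Y K) = 0"
      using br_skew[of Y K] by simp
  qed
  have split: "w1 (br X Y) = of_real (Im (cnj (w1 X) * w1 Y)) * w1 (br e1 (J e1))" for X Y
  proof -
    have "w1 (br X Y) = w1 (br (X - cscale J (w1 X) e1) Y) + w1 (br (cscale J (w1 X) e1) (Y - cscale J (w1 Y) e1))
       + w1 (br (cscale J (w1 X) e1) (cscale J (w1 Y) e1))"
      by simp
    also have "w1 (br (X - cscale J (w1 X) e1) Y) = 0"
      by (rule ker) simp
    also have "w1 (br (cscale J (w1 X) e1) (Y - cscale J (w1 Y) e1)) = 0"
      by (rule ker) simp
    finally show ?thesis
      by (simp add: br_cscale_same del: complex_cnj_mult)
  qed
  have "w1 (br e1 (J e1)) = 0"
  proof (rule ccontr)
    let ?c = "w1 (br e1 (J e1))"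
    assume c: "?c \<noteq> 0"
    have "0 \<in> {v. w1 v = ?c}"
    proof (rule bracket_escape)
      have "cscale J ?c e1 \<in> {v. w1 v = ?c}" by simp
      then show "{v. w1 v = ?c} \<noteq> {}" by blast
      fix v assume v: "v \<in> {v. w1 v = ?c}"
      have "w1 (br (cscale J (- \<i> / cnj ?c) e1) v) = of_real (Im (cnj (- \<i> / cnj ?c) * ?c)) * ?c"
        using split[of "cscale J (- \<i> / cnj ?c) e1" v] v by simp
      also have "cnj (- \<i> / cnj ?c) * ?c = \<i>"
        using c by simp
      finally have "br (cscale J (- \<i> / cnj ?c) e1) v \<in> {v. w1 v = ?c}" by simp
      then show "\<exists>X. br X v \<in> {v. w1 v = ?c}" ..
    qed
    then show False using c by simp
  qed
  then show ?thesis using split[of X Y] by simp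
qed

lemma br_e1_e2_sym:
  "w2 (br e1 (J e2)) = w2 (br (J e1) e2)" "w3 (br e1 (J e2)) = w3 (br (J e1) e2)"
proof -
  have i: "cscale J \<i> X = J X" for X by (simp add: cscale_def)
  have s: "br e2 (J e1) = - br (J e1) e2" by (rule br_skew)
  show "w2 (br e1 (J e2)) = w2 (br (J e1) e2)" "w3 (br e1 (J e2)) = w3 (br (J e1) e2)"
    using ad_e3_leibniz(2,3)[of e1 "J e1"] by (simp_all add: i s w1_br cscale_simps)
qed

lemma br_Je1_Je2:
  "w2 (br (J e1) (J e2)) = w2 (br e1 e2) + 2 * \<i> * w2 (br e1 (J e2))"
  "w3 (br (J e1) (J e2)) = w3 (br e1 e2) + 2 * \<i> * w3 (br e1 (J e2))"
  using nijenhuis[of e1 e2] by (simp_all add: br_e1_e2_sym)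

text \<open>
  If some bracket with the complex line of \<open>e2\<close> had an \<open>e3\<close>-component, then modulo the ideal \<open>I\<close>
  spanned by \<open>J e3\<close> and the kernel of the three forms each of \<open>e3\<close>, \<open>e2\<close>, \<open>J e2\<close> would be generated by brackets with
  these three vectors (\<open>e2\<close> and \<open>J e2\<close> come from \<open>e3\<close>), contradicting \<open>bracket_absorb\<close>.
\<close>

lemma Re_w3_br_e2: "Re (w3 (br X (cscale J c e2))) = 0"
proof (rule ccontr)
  let ?b = "br X (cscale J c e2)"
  let ?r = "Re (w3 ?b)"
  assume r: "?r \<noteq> 0"
  let ?I = "{x. w1 x = 0 \<and> w2 x = 0 \<and> Re (w3 x) = 0}"
  let ?S = "{e3, e2, J e2}"
  let ?B = "{br X v | X v. v \<in> ?S} \<union> ?I"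
  have "?S \<subseteq> ?I"
  proof (rule bracket_absorb)
    show "subspace ?I" by (simp add: subspace_def)
    show "br X x \<in> ?I" if "x \<in> ?I" for X x
    proof -
      have "br x X = br (Im (w3 x) *\<^sub>R J e3) X"
        using that by (intro br_cong) (simp_all add: complex_eq_iff)
      then have "br X x = - (Im (w3 x) *\<^sub>R br (J e3) X)"
        using br_skew[of X x] by simp
      then show ?thesis by simp
    qed
    have gen: "br X v \<in> span ?B" if "v \<in> ?S" for X v
      using that by (intro span_base) blast
    have I: "x \<in> span ?B" if "x \<in> ?I" for x
      using that by (intro span_base) blast
    have ad: "br X e3 = - br e3 X" for X by (rule br_skew)
    have "e2 + (1/2) *\<^sub>R br e1 e3 \<in> span ?B"
      by (rule I) (simp add: ad)
    from span_diff[OF this span_scale[OF gen, of e3 "1/2" e1]] have e2: "e2 \<in> span ?B"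
      by simp
    have "J e2 + (1/2) *\<^sub>R br (J e1) e3 \<in> span ?B"
      by (rule I) (simp add: ad)
    from span_diff[OF this span_scale[OF gen, of e3 "1/2" "J e1"]] have Je2: "J e2 \<in> span ?B"
      by simp
    have "?b = Re c *\<^sub>R br X e2 + Im c *\<^sub>R br X (J e2)"
      by (simp add: cscale_def)
    then have b: "?b \<in> span ?B"
      by (simp only:) (intro span_add span_scale gen, simp_all)
    have cs: "cscale J z e2 \<in> span ?B" for z
      unfolding cscale_def by (intro span_add span_scale e2 Je2)
    let ?z = "- w2 ?b / of_real ?r"
    have "e3 - ((1 / ?r) *\<^sub>R ?b + cscale J ?z e2) \<in> span ?B"
      using r by (intro I) (simp add: w1_br)
    moreover have "(1 / ?r) *\<^sub>R ?b + cscale J ?z e2 \<in> span ?B"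
      by (intro span_add span_scale b cs)
    ultimately have "e3 - ((1 / ?r) *\<^sub>R ?b + cscale J ?z e2) + ((1 / ?r) *\<^sub>R ?b + cscale J ?z e2) \<in> span ?B"
      by (rule span_add)
    then have "e3 \<in> span ?B"
      by (simp only: diff_add_cancel)
    with e2 Je2 show "s \<in> span ?B" if "s \<in> ?S" for s
      using that by blast
  qed
  then have "e3 \<in> ?I" by blast
  then show False by simp
qed

text \<open>
  On the complex line of \<open>e2\<close>, modulo \<open>J e3\<close> and the kernel of the three forms, \<open>ad e1\<close> sends
  \<open>e2, J e2\<close> to \<open>u, s\<close> and \<open>ad (J e1)\<close> sends them to \<open>s, u + 2 \<i> s\<close>. Nilpotency provides a common kernel vector
  \<open>p\<close>, and eliminating \<open>u\<close> from its two equations leaves \<open>s p\<^sup>2 = 0\<close>.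
\<close>

lemma br_e1_e2_w2: "w2 (br e1 e2) = 0" "w2 (br e1 (J e2)) = 0"
proof -
  let ?V = "{v. w1 v = 0 \<and> w2 v \<noteq> 0 \<and> Re (w3 v) = 0}"
  have red: "br X v = br X (cscale J (w2 v) e2) + Im (w3 v) *\<^sub>R br X (J e3)" if "v \<in> ?V" for X v
  proof -
    have "br X v = br X (cscale J (w2 v) e2 + Im (w3 v) *\<^sub>R J e3)"
      using that by (intro br_cong) (simp_all add: complex_eq_iff)
    then show ?thesis by simp
  qed
  have Je3: "br X (J e3) = - br (J e3) X" for X by (rule br_skew)
  have "\<exists>v\<in>?V. w2 (br e1 v) = 0 \<and> w2 (br (J e1) v) = 0"
  proof (rule ccontr)
    assume *: "\<not> ?thesis"
    have "0 \<in> ?V"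
    proof (rule bracket_escape)
      have "e2 \<in> ?V" by simp
      then show "?V \<noteq> {}" by blast
      fix v assume v: "v \<in> ?V"
      then obtain X where X: "w2 (br X v) \<noteq> 0" using * by blast
      have "Re (w3 (br X v)) = 0"
        by (simp add: red[OF v] Je3 Re_w3_br_e2)
      with X have "br X v \<in> ?V" by (simp add: w1_br)
      then show "\<exists>X. br X v \<in> ?V" ..
    qed
    then show False by simp
  qed
  then obtain v where v: "v \<in> ?V" "w2 (br e1 v) = 0" "w2 (br (J e1) v) = 0" by blast
  define p where "p = w2 v"
  have p: "p \<noteq> 0" using v(1) by (simp add: p_def)
  define u s where "u = w2 (br e1 e2)" and "s = w2 (br e1 (J e2))"
  have A: "of_real (Re p) * u + of_real (Im p) * s = 0"
    using v(2) by (simp add: red[OF v(1)] Je3 cscale_def u_def s_def p_def)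
  have B: "of_real (Re p) * s + of_real (Im p) * (u + 2 * \<i> * s) = 0"
    using v(3) by (simp add: red[OF v(1)] Je3 cscale_def u_def s_def p_def br_Je1_Je2 br_e1_e2_sym[symmetric])
  have "s * (of_real (Re p) + \<i> * of_real (Im p))\<^sup>2
      = of_real (Re p) * (of_real (Re p) * s + of_real (Im p) * (u + 2 * \<i> * s))
        - of_real (Im p) * (of_real (Re p) * u + of_real (Im p) * s)"
    by (simp add: power2_eq_square algebra_simps)
  also have "\<dots> = 0" by (simp only: A B) simp
  finally have s: "s = 0" using p by (simp flip: complex_eq)
  have "u = 0"
    using A B p by (auto simp: s complex_eq_iff)
  with s show "w2 (br e1 e2) = 0" "w2 (br e1 (J e2)) = 0" by (simp_all add: u_def s_def)
qed

lemma br_e1_e2_w3: "Re (w3 (br e1 e2)) = 0" "w3 (br e1 (J e2)) = 0"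
proof -
  have cs: "cscale J 1 e2 = e2" "cscale J \<i> e2 = J e2" by (simp_all add: cscale_def)
  show "Re (w3 (br e1 e2)) = 0"
    using Re_w3_br_e2[of e1 1] by (simp add: cs)
  then show "w3 (br e1 (J e2)) = 0"
    using Re_w3_br_e2[of e1 \<i>] Re_w3_br_e2[of "J e1" \<i>] by (simp add: cs br_Je1_Je2 complex_eq_iff)
qed

lemma br_e1_e2_cscale:
  "w2 (br (cscale J b e1) (cscale J c e2)) = 0"
  "w3 (br (cscale J b e1) (cscale J c e2)) = of_real (Re (cnj b * c)) * w3 (br e1 e2)"
  by (simp_all add: cscale_def br_e1_e2_w2 br_e1_e2_w3 br_Je1_Je2 br_e1_e2_sym[symmetric] algebra_simps)

lemma br_ker_w1:
  assumes "w1 X = 0" "w1 Y = 0"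
  shows "w2 (br X Y) = 0" "w3 (br X Y) = 0"
proof -
  have Y: "br X Y = br X (cscale J (w2 Y) e2 + cscale J (w3 Y) e3)"
    by (rule br_cong) (simp_all add: assms)
  have e3: "br X (cscale J c e3) = - br (cscale J c e3) X" for c by (rule br_skew)
  show "w2 (br X Y) = 0" "w3 (br X Y) = 0"
    by (simp_all add: Y br_ker_w1_e2[OF assms(1)] e3 ad_cscale_e3 assms(1))
qed

text \<open>
  All brackets modulo the stable ideal, in terms of the three constants that are still free:
  the two components of \<open>[e1, J e1]\<close> and the \<open>e3\<close>-component of \<open>[e1, e2]\<close>.
\<close>

lemma w2_w3_br:
  shows "w2 (br X Y) = of_real (Im (cnj (w1 X) * w1 Y)) * w2 (br e1 (J e1))
      - 2 * w1 X * of_real (Re (w3 Y)) + 2 * w1 Y * of_real (Re (w3 X))"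
    and "w3 (br X Y) = of_real (Im (cnj (w1 X) * w1 Y)) * w3 (br e1 (J e1))
      + of_real (Re (cnj (w1 X) * w2 Y) - Re (cnj (w1 Y) * w2 X)) * w3 (br e1 e2)"
proof -
  have e3: "br X (cscale J c e3) = - br (cscale J c e3) X" for c X by (rule br_skew)
  have K: "w2 (br (cscale J b e1) K) = - 2 * b * of_real (Re (w3 K))"
      "w3 (br (cscale J b e1) K) = of_real (Re (cnj b * w2 K)) * w3 (br e1 e2)"
    if "w1 K = 0" for b K
  proof -
    have "br (cscale J b e1) K = br (cscale J b e1) (cscale J (w2 K) e2 + cscale J (w3 K) e3)"
      by (rule br_cong) (simp_all add: that)
    then have "br (cscale J b e1) K = br (cscale J b e1) (cscale J (w2 K) e2)
        - br (cscale J (w3 K) e3) (cscale J b e1)"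
      by (simp add: e3)
    then show "w2 (br (cscale J b e1) K) = - 2 * b * of_real (Re (w3 K))"
      "w3 (br (cscale J b e1) K) = of_real (Re (cnj b * w2 K)) * w3 (br e1 e2)"
      by (simp_all add: br_e1_e2_cscale ad_cscale_e3)
  qed
  let ?X = "X - cscale J (w1 X) e1" and ?Y = "Y - cscale J (w1 Y) e1"
  have 0: "w1 ?X = 0" "w1 ?Y = 0" by simp_all
  have "br X Y = br (cscale J (w1 X) e1) (cscale J (w1 Y) e1) + br (cscale J (w1 X) e1) ?Y
      - br (cscale J (w1 Y) e1) ?X + br ?X ?Y"
    using br_skew[of "cscale J (w1 Y) e1" X] br_skew[of "cscale J (w1 X) e1" "cscale J (w1 Y) e1"] by simp
  then have *: "br X Y = Im (cnj (w1 X) * w1 Y) *\<^sub>R br e1 (J e1) + br (cscale J (w1 X) e1) ?Y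
      - br (cscale J (w1 Y) e1) ?X + br ?X ?Y"
    by (simp only: br_cscale_same)
  show "w2 (br X Y) = of_real (Im (cnj (w1 X) * w1 Y)) * w2 (br e1 (J e1))
      - 2 * w1 X * of_real (Re (w3 Y)) + 2 * w1 Y * of_real (Re (w3 X))"
    unfolding * using br_ker_w1[OF 0]
    by (simp only: w_simps K[OF 0(1)] K[OF 0(2)]) simp
  show "w3 (br X Y) = of_real (Im (cnj (w1 X) * w1 Y)) * w3 (br e1 (J e1))
      + of_real (Re (cnj (w1 X) * w2 Y) - Re (cnj (w1 Y) * w2 X)) * w3 (br e1 e2)"
    unfolding * using br_ker_w1[OF 0]
    by (simp only: w_simps K[OF 0(1)] K[OF 0(2)]) (simp add: algebra_simps)
qed

text \<open>
  Otherwise \<open>e2\<close> and \<open>J e2\<close> would both be central modulo the ideal, against stability.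
\<close>

lemma w3_br_e1_e2_nz: "w3 (br e1 e2) \<noteq> 0"
proof
  assume 0: "w3 (br e1 e2) = 0"
  have "w2 (br e2 Y) = 0" "w3 (br e2 Y) = 0" "w2 (br (J e2) Y) = 0" "w3 (br (J e2) Y) = 0" for Y
    using w2_w3_br[of e2 Y] w2_w3_br[of "J e2" Y] by (simp_all add: 0)
  note van = this
  have "w1 e2 = 0 \<and> w2 e2 = 0 \<and> w3 e2 = 0"
    by (rule stable) (simp_all add: w1_br van)
  then show False by simp
qed

lemma structure_mod_stable_ideal:
  obtains k \<tau> :: complex and \<delta> :: real where "\<delta> \<noteq> 0"
    "\<And>X Y. w1 (br X Y) = 0"
    "\<And>X Y. - w2 (br X Y) = w1 X * (w3 Y + cnj (w3 Y)) - w1 Y * (w3 X + cnj (w3 X))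
       + k * (w1 X * cnj (w1 Y) - w1 Y * cnj (w1 X))"
    "\<And>X Y. - w3 (br X Y) = \<tau> * (w1 X * cnj (w1 Y) - w1 Y * cnj (w1 X))
       + \<i> * of_real \<delta> * (w1 X * cnj (w2 Y) - w1 Y * cnj (w2 X) - w2 X * cnj (w1 Y) + w2 Y * cnj (w1 X))"
proof (rule that[of "- Im (w3 (br e1 e2)) / 2" "w2 (br e1 (J e1)) * (- \<i> / 2)" "w3 (br e1 (J e1)) * (- \<i> / 2)"])
  have mu: "w3 (br e1 e2) = \<i> * of_real (Im (w3 (br e1 e2)))"
    using br_e1_e2_w3(1) by (simp add: complex_eq_iff)
  show "- Im (w3 (br e1 e2)) / 2 \<noteq> 0"
    using w3_br_e1_e2_nz mu by auto
  have Im: "of_real (Im z) = (z - cnj z) * (- \<i> / 2)" and Re: "of_real (Re z) = (z + cnj z) / 2" for z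
    by (simp_all add: complex_eq_iff)
  fix X Y
  show "w1 (br X Y) = 0" by (rule w1_br)
  show "- w2 (br X Y) = w1 X * (w3 Y + cnj (w3 Y)) - w1 Y * (w3 X + cnj (w3 X))
       + w2 (br e1 (J e1)) * (- \<i> / 2) * (w1 X * cnj (w1 Y) - w1 Y * cnj (w1 X))"
    unfolding w2_w3_br(1)[of X Y] Im[of "cnj (w1 X) * w1 Y"] Re complex_cnj_mult complex_cnj_cnj
    by algebra
  show "- w3 (br X Y) = w3 (br e1 (J e1)) * (- \<i> / 2) * (w1 X * cnj (w1 Y) - w1 Y * cnj (w1 X))
       + \<i> * of_real (- Im (w3 (br e1 e2)) / 2) *
        (w1 X * cnj (w2 Y) - w1 Y * cnj (w2 X) - w2 X * cnj (w1 Y) + w2 Y * cnj (w1 X))"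
  proof -
    define m where "m = complex_of_real (Im (w3 (br e1 e2)))"
    have "complex_of_real (- Im (w3 (br e1 e2)) / 2) = - m / 2"
      by (simp add: m_def)
    moreover have "w3 (br e1 e2) = \<i> * m"
      using mu by (simp add: m_def)
    ultimately show ?thesis
      unfolding w2_w3_br(2)[of X Y] of_real_diff Im[of "cnj (w1 X) * w1 Y"] Re
        complex_cnj_mult complex_cnj_cnj
      by algebra
  qed
qed

end

section \<open>Structure equations in terms of single forms\<close>

definition base_eqs :: "('a \<Rightarrow> 'a \<Rightarrow> 'a) \<Rightarrow> 'a form \<Rightarrow> 'a form \<Rightarrow> 'a form \<Rightarrow> real \<Rightarrow> real \<Rightarrow> bool" where
  "base_eqs br w1 w2 w3 \<epsilon> \<delta> \<longleftrightarrow>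
     (\<forall>X Y. w1 (br X Y) = 0) \<and>
     (\<forall>X Y. - w2 (br X Y) = wedge w1 w3 X Y + wedge w1 (conj_form w3) X Y) \<and>
     (\<forall>X Y. - w3 (br X Y) = \<i> * of_real \<epsilon> * wedge w1 (conj_form w1) X Y
        + \<i> * of_real \<delta> * (wedge w1 (conj_form w2) X Y - wedge w2 (conj_form w1) X Y))"

text \<open>
  The parameters \<open>\<nu>\<close> and \<open>a\<close> are complex here because they become real only after the last rescaling.
\<close>

definition full_eqs ::
    "('a \<Rightarrow> 'a \<Rightarrow> 'a) \<Rightarrow> 'a form \<Rightarrow> 'a form \<Rightarrow> 'a form \<Rightarrow> 'a form \<Rightarrow>
     real \<Rightarrow> real \<Rightarrow> complex \<Rightarrow> complex \<Rightarrow> complex \<Rightarrow> bool" where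
  "full_eqs br w1 w2 w3 w4 \<epsilon> \<delta> \<nu> a B \<longleftrightarrow> base_eqs br w1 w2 w3 \<epsilon> \<delta> \<and>
     (\<forall>X Y. - w4 (br X Y) = a * wedge w1 w2 X Y + B * wedge w1 (conj_form w1) X Y
        + \<nu> * (wedge w2 w3 X Y + 2 * of_real \<delta> * of_real \<epsilon> * wedge w1 (conj_form w3) X Y
             + wedge w2 (conj_form w3) X Y))"

lemma structure_equations_iff:
  "structure_equations br \<omega> \<epsilon> \<delta> \<nu> a B \<longleftrightarrow>
     full_eqs br (\<omega> 1) (\<omega> 2) (\<omega> 3) (\<omega> 4) \<epsilon> \<delta> (of_real \<nu>) (of_real a) B"
  by (simp add: structure_equations_def full_eqs_def base_eqs_def ext_diff_def scale_form2_def
      fun_eq_iff Let_def algebra_simps)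

section \<open>The differential of the fourth form\<close>

text \<open>
  The 2-form \<open>- \<alpha> \<circ> br\<close> has four real-bilinear components on a pair of complex lines. The
  integrability condition removes the one that is antilinear in both arguments, and skew-symmetry
  identifies the two mixed ones, so the (2,0)-part \<open>p\<close> and the (1,1)-part \<open>q\<close> remain.
\<close>

lemma (in nilpotent_cplx) type_decomposition_pair:
  assumes \<alpha>: "\<alpha> \<in> forms_1_0 J"
  defines "q \<equiv> \<lambda>X Y. - (\<alpha> (br X Y) + \<i> * \<alpha> (br X (J Y))) / 2"
    and "p \<equiv> \<lambda>X Y. \<i> * (\<alpha> (br X (J Y)) + \<alpha> (br (J X) Y)) / 2"
  shows "- \<alpha> (br (cscale J x X) (cscale J y Y)) = x * y * p X Y + x * cnj y * q X Y - cnj x * y * q Y X"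
    and "p Y X = - p X Y"
proof -
  note ap = forms_1_0_apply[OF \<alpha>]
  have nij: "\<alpha> (br (J X) (J Y)) = \<alpha> (br X Y) + \<i> * \<alpha> (br (J X) Y) + \<i> * \<alpha> (br X (J Y))"
    using arg_cong[OF nijenhuis[of X Y], of \<alpha>] by (simp add: ap)
  have skew: "\<alpha> (br Y X) = - \<alpha> (br X Y)" for X Y
    using br_skew[of Y X] by (simp add: ap)
  have cj: "x = of_real (Re x) + \<i> * of_real (Im x)" "cnj x = of_real (Re x) - \<i> * of_real (Im x)" for x
    by (simp_all add: complex_eq_iff)
  show "- \<alpha> (br (cscale J x X) (cscale J y Y)) = x * y * p X Y + x * cnj y * q X Y - cnj x * y * q Y X"
  proof -
    have ii: "\<i> * \<i> = (-1 :: complex)" by simp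
    have expand: "\<alpha> (br (cscale J x X) (cscale J y Y)) =
        of_real (Re x) * of_real (Re y) * \<alpha> (br X Y) + of_real (Re x) * of_real (Im y) * \<alpha> (br X (J Y))
        + of_real (Im x) * of_real (Re y) * \<alpha> (br (J X) Y)
        + of_real (Im x) * of_real (Im y) * (\<alpha> (br X Y) + \<i> * \<alpha> (br (J X) Y) + \<i> * \<alpha> (br X (J Y)))"
      by (simp add: cscale_def ap nij algebra_simps)
    show ?thesis
      unfolding p_def q_def skew[of Y X] skew[of Y "J X"] expand
      using cj(1)[of x] cj(1)[of y] cj(2)[of x] cj(2)[of y] ii by algebra
  qed
  show "p Y X = - p X Y"
    unfolding p_def using skew[of Y "J X"] skew[of "J Y" X] by algebra
qed

lemma (in nilpotent_cplx) type_decomposition: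
  assumes dim: "dim (UNIV :: 'a set) = 8" and cf: "coframe J w1 w2 w3 w4"
    and central: "\<And>X Y. w1 X = 0 \<Longrightarrow> w2 X = 0 \<Longrightarrow> w3 X = 0 \<Longrightarrow> br X Y = 0"
    and \<alpha>: "\<alpha> \<in> forms_1_0 J"
  obtains a12 a13 a23 c11 c12 c13 c21 c22 c23 c31 c32 c33 where
    "\<And>X Y. - \<alpha> (br X Y) = a12 * wedge w1 w2 X Y + a13 * wedge w1 w3 X Y + a23 * wedge w2 w3 X Y
       + c11 * wedge w1 (conj_form w1) X Y + c12 * wedge w1 (conj_form w2) X Y + c13 * wedge w1 (conj_form w3) X Y
       + c21 * wedge w2 (conj_form w1) X Y + c22 * wedge w2 (conj_form w2) X Y + c23 * wedge w2 (conj_form w3) X Y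
       + c31 * wedge w3 (conj_form w1) X Y + c32 * wedge w3 (conj_form w2) X Y + c33 * wedge w3 (conj_form w3) X Y"
proof -
  obtain e1 where e1: "w1 e1 = 1" "w2 e1 = 0" "w3 e1 = 0" "w4 e1 = 0" by (rule coframe_surj[OF dim cf])
  obtain e2 where e2: "w1 e2 = 0" "w2 e2 = 1" "w3 e2 = 0" "w4 e2 = 0" by (rule coframe_surj[OF dim cf])
  obtain e3 where e3: "w1 e3 = 0" "w2 e3 = 0" "w3 e3 = 1" "w4 e3 = 0" by (rule coframe_surj[OF dim cf])
  note apw = coframe_forms[OF cf, THEN forms_1_0_apply(1)] coframe_forms[OF cf, THEN forms_1_0_apply(7)]
    coframe_forms[OF cf, THEN forms_1_0_apply(2)]
  note ap = forms_1_0_apply[OF \<alpha>]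
  define r where "r X = cscale J (w1 X) e1 + cscale J (w2 X) e2 + cscale J (w3 X) e3" for X
  have left: "br X Y = br (r X) Y" for X Y
  proof -
    have "br (X - r X) Y = 0"
      by (rule central) (simp_all add: r_def apw e1 e2 e3)
    then show ?thesis by simp
  qed
  have rr: "br X Y = br (r X) (r Y)" for X Y
    using left[of X Y] left[of Y "r X"] br_skew[of "r X" Y] br_skew[of "r X" "r Y"] by simp
  define q where "q X Y = - (\<alpha> (br X Y) + \<i> * \<alpha> (br X (J Y))) / 2" for X Y
  define p where "p X Y = \<i> * (\<alpha> (br X (J Y)) + \<alpha> (br (J X) Y)) / 2" for X Y
  have d: "\<alpha> (br (cscale J x X) (cscale J y Y)) = - (x * y * p X Y + x * cnj y * q X Y - cnj x * y * q Y X)" for x y X Y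
    using type_decomposition_pair(1)[OF \<alpha>, of x X y Y] unfolding p_def q_def
    by (metis minus_minus)
  have skew: "p Y X = - p X Y" for X Y
    using type_decomposition_pair(2)[OF \<alpha>, of Y X] unfolding p_def by simp
  have self: "p X X = 0" for X
    using skew[of X X] by simp
  show ?thesis
  proof (rule that[of "p e1 e2" "p e1 e3" "p e2 e3" "q e1 e1" "q e1 e2" "q e1 e3"
        "q e2 e1" "q e2 e2" "q e2 e3" "q e3 e1" "q e3 e2" "q e3 e3"])
    fix X Y
    show "- \<alpha> (br X Y) = p e1 e2 * wedge w1 w2 X Y + p e1 e3 * wedge w1 w3 X Y + p e2 e3 * wedge w2 w3 X Y
       + q e1 e1 * wedge w1 (conj_form w1) X Y + q e1 e2 * wedge w1 (conj_form w2) X Y + q e1 e3 * wedge w1 (conj_form w3) X Y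
       + q e2 e1 * wedge w2 (conj_form w1) X Y + q e2 e2 * wedge w2 (conj_form w2) X Y + q e2 e3 * wedge w2 (conj_form w3) X Y
       + q e3 e1 * wedge w3 (conj_form w1) X Y + q e3 e2 * wedge w3 (conj_form w2) X Y + q e3 e3 * wedge w3 (conj_form w3) X Y"
      unfolding rr[of X Y] unfolding r_def br_simps ap d wedge_def conj_form_def
        self skew[of e2 e1] skew[of e3 e1] skew[of e3 e2]
      by algebra
  qed
qed

text \<open>
  The Jacobi identity, evaluated at the triples of basis vectors that isolate one coefficient or a pair
  of coefficients each. For the form \<open>w4\<close> it says that the given 2-form is closed.
\<close>

lemma closed_coefficients:
  fixes a12 :: complex
  assumes nil: "nilpotent_lie_algebra br"
    and dim: "dim (UNIV :: 'a::real_vector set) = 8" and cf: "coframe J w1 w2 w3 w4"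
    and base: "base_eqs br w1 w2 w3 \<epsilon> \<delta>" and \<delta>: "\<delta> \<noteq> 0"
    and d4: "\<And>X Y :: 'a. - w4 (br X Y) = a12 * wedge w1 w2 X Y + a13 * wedge w1 w3 X Y + a23 * wedge w2 w3 X Y
       + c11 * wedge w1 (conj_form w1) X Y + c12 * wedge w1 (conj_form w2) X Y + c13 * wedge w1 (conj_form w3) X Y
       + c21 * wedge w2 (conj_form w1) X Y + c22 * wedge w2 (conj_form w2) X Y + c23 * wedge w2 (conj_form w3) X Y
       + c31 * wedge w3 (conj_form w1) X Y + c32 * wedge w3 (conj_form w2) X Y + c33 * wedge w3 (conj_form w3) X Y"
  shows "c22 = 0" "c31 = 0" "c32 = 0" "c33 = 0" "c21 = - c12" "c23 = a23"
    "of_real \<delta> * (c13 - a13) = 2 * of_real \<epsilon> * a23"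
proof -
  obtain e1 where e1: "w1 e1 = 1" "w2 e1 = 0" "w3 e1 = 0" "w4 e1 = 0" by (rule coframe_surj[OF dim cf])
  obtain e2 where e2: "w1 e2 = 0" "w2 e2 = 1" "w3 e2 = 0" "w4 e2 = 0" by (rule coframe_surj[OF dim cf])
  obtain e3 where e3: "w1 e3 = 0" "w2 e3 = 0" "w3 e3 = 1" "w4 e3 = 0" by (rule coframe_surj[OF dim cf])
  note wJ = coframe_forms[OF cf, THEN forms_1_0_apply(6)]
  have w4_br: "w4 (br X Y) = - (a12 * wedge w1 w2 X Y + a13 * wedge w1 w3 X Y + a23 * wedge w2 w3 X Y
       + c11 * wedge w1 (conj_form w1) X Y + c12 * wedge w1 (conj_form w2) X Y + c13 * wedge w1 (conj_form w3) X Y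
       + c21 * wedge w2 (conj_form w1) X Y + c22 * wedge w2 (conj_form w2) X Y + c23 * wedge w2 (conj_form w3) X Y
       + c31 * wedge w3 (conj_form w1) X Y + c32 * wedge w3 (conj_form w2) X Y + c33 * wedge w3 (conj_form w3) X Y)" for X Y
    using d4[of X Y] by (metis minus_minus)
  have b: "w1 (br X Y) = 0" "w2 (br X Y) = - (wedge w1 w3 X Y + wedge w1 (conj_form w3) X Y)"
    "w3 (br X Y) = - (\<i> * of_real \<epsilon> * wedge w1 (conj_form w1) X Y
        + \<i> * of_real \<delta> * (wedge w1 (conj_form w2) X Y - wedge w2 (conj_form w1) X Y))" for X Y
    using base unfolding base_eqs_def by (blast, (metis minus_minus)+)
  have jac: "w4 (br X (br Y Z)) + w4 (br Y (br Z X)) + w4 (br Z (br X Y)) = 0" for X Y Z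
  proof -
    have "br X (br Y Z) + br Y (br Z X) + br Z (br X Y) = 0"
      using nil by (simp add: nilpotent_lie_algebra_def lie_algebra_def)
    from arg_cong[OF this, of w4] show ?thesis
      using coframe_forms(4)[OF cf] by (simp add: forms_1_0_apply)
  qed
  have ii: "\<i> * \<i> = (-1 :: complex)" by simp
  note simps = w4_br b wedge_def conj_form_def wJ e1 e2 e3
  have 1: "of_real \<delta> * (c23 - a23 - c32) = 0"
    using jac[of e1 e2 "J e2", simplified simps, simplified] ii by algebra
  have 2: "of_real \<delta> * (c23 - a23 + c32) = 0"
    using jac[of "J e1" e2 "J e2", simplified simps, simplified] ii by algebra
  show c32: "c32 = 0"
    using 1 2 \<delta> by simp
  show c23: "c23 = a23"
    using 1 \<delta> c32 by simp
  have 3: "of_real \<epsilon> * (a23 + c23 - c32) + of_real \<delta> * (a13 - c13 + c31) = 0"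
    using jac[of e1 "J e1" e2, simplified simps, simplified] ii by algebra
  have 4: "of_real \<epsilon> * (a23 + c23 + c32) + of_real \<delta> * (a13 - c13 - c31) = 0"
    using jac[of e1 "J e1" "J e2", simplified simps, simplified] ii by algebra
  have "of_real \<delta> * c31 = 0"
    using 3 4 c32 by algebra
  then show "c31 = 0" using \<delta> by simp
  then show "of_real \<delta> * (c13 - a13) = 2 * of_real \<epsilon> * a23"
    using 3 c32 c23 by algebra
  have "of_real \<delta> * c33 = 0"
    using jac[of e1 e2 e3] by (auto simp: simps)
  then show "c33 = 0" using \<delta> by simp
  show "c22 = 0"
    using jac[of e1 "J e2" e3] by (simp add: simps)
  show "c21 = - c12"
    using jac[of e1 "J e1" e3, simplified simps, simplified] ii by algebra
qed

section \<open>Normalisation of the equations\<close>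

text \<open>
  Adding \<open>cnj k w1\<close> to \<open>w3\<close> absorbs the term with \<open>k\<close>, and adding a purely imaginary multiple \<open>v w1\<close> to \<open>w2\<close>
  makes the coefficient \<open>\<tau>\<close> purely imaginary. The factor \<open>m\<close> then scales \<open>\<delta>\<close> to its sign, and \<open>r\<close>
  scales \<open>\<epsilon>\<close> to 1 unless it is 0.
\<close>

lemma ex_normalized_base:
  fixes br :: "'a::real_vector \<Rightarrow> 'a \<Rightarrow> 'a"
  assumes "nilpotent_lie_algebra br" "complex_structure br J" "weakly_non_nilpotent br J"
    and dim: "dim (UNIV :: 'a set) = 8"
  obtains w1 w2 w3 w4 \<epsilon> \<delta> where "coframe J w1 w2 w3 w4" "base_eqs br w1 w2 w3 \<epsilon> \<delta>"
    "\<epsilon> \<in> {0, 1}" "\<delta> \<in> {1, -1}"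
    "\<And>X Y. w1 X = 0 \<Longrightarrow> w2 X = 0 \<Longrightarrow> w3 X = 0 \<Longrightarrow> br X Y = 0"
proof -
  interpret nilpotent_cplx br J
    by unfold_locales (fact assms)+
  obtain w1 w2 w3 w4 e1 e2 e3 where ad: "adapted_coframe br J w1 w2 w3 w4 e1 e2 e3"
    by (rule ex_adapted_coframe[OF dim assms(3)])
  obtain k \<tau> \<Delta> where \<Delta>: "\<Delta> \<noteq> 0" and w1: "\<And>X Y. w1 (br X Y) = 0"
    and w2: "\<And>X Y. - w2 (br X Y) = w1 X * (w3 Y + cnj (w3 Y)) - w1 Y * (w3 X + cnj (w3 X))
       + k * (w1 X * cnj (w1 Y) - w1 Y * cnj (w1 X))"
    and w3: "\<And>X Y. - w3 (br X Y) = \<tau> * (w1 X * cnj (w1 Y) - w1 Y * cnj (w1 X))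
       + \<i> * of_real \<Delta> * (w1 X * cnj (w2 Y) - w1 Y * cnj (w2 X) - w2 X * cnj (w1 Y) + w2 Y * cnj (w1 X))"
    using adapted_coframe.structure_mod_stable_ideal[OF ad] by metis
  have cf: "coframe J w1 w2 w3 w4"
    by (rule adapted_coframe.cf[OF ad])
  have central: "br X Y = 0" if "w1 X = 0" "w2 X = 0" "w3 X = 0" for X Y
    by (rule adapted_coframe.central[OF ad that])
  define m where "m = sqrt \<bar>\<Delta>\<bar>"
  define E where "E = (if Im \<tau> = 0 then 0 else 1 :: real)"
  define r where "r = (if Im \<tau> = 0 then 1 else m\<^sup>2 / Im \<tau>)"
  define v where "v = \<i> * of_real (Re \<tau> / (2 * \<Delta>))"
  define S where "S = sgn \<Delta>"
  have m: "m \<noteq> 0" "m * m = S * \<Delta>" using \<Delta> by (auto simp: m_def S_def sgn_if)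
  have r: "r \<noteq> 0" "r * Im \<tau> = E * (m * m)" using m(1) by (auto simp: r_def E_def power2_eq_square)
  have S: "S * S = 1" "S \<in> {1, -1}" using \<Delta> by (auto simp: S_def sgn_if)
  let ?w1 = "\<lambda>X. of_real m * w1 X"
  let ?w2 = "\<lambda>X. of_real (m * r) * (w2 X + v * w1 X)"
  let ?w3 = "\<lambda>X. of_real r * (w3 X + cnj k * w1 X)"
  show ?thesis
  proof (rule that[of ?w1 ?w2 ?w3 w4 E S])
    note f = coframe_forms[OF cf]
    show "coframe J ?w1 ?w2 ?w3 w4"
      using cf m(1) r(1) f unfolding coframe_def by (auto simp: forms_1_0_scale forms_1_0_add)
    show "E \<in> {0, 1}" by (simp add: E_def)
    show "S \<in> {1, -1}" by (fact S)
    show "br X Y = 0" if "?w1 X = 0" "?w2 X = 0" "?w3 X = 0" for X Y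
      by (rule central) (use that m(1) r(1) in auto)
    define M R D T U where "M = complex_of_real m" and "R = complex_of_real r" and "D = complex_of_real \<Delta>"
      and "T = complex_of_real (Re \<tau>)" and "U = complex_of_real (Im \<tau>)"
    have cM: "cnj M = M" and cR: "cnj R = R" by (simp_all add: M_def R_def)
    have MM: "M * M = of_real S * D" unfolding M_def D_def using m(2) by (metis of_real_mult)
    have RU: "R * U = of_real E * (M * M)" unfolding M_def R_def U_def using r(2) by (metis of_real_mult)
    have SS: "of_real S * of_real S = (1 :: complex)" using S(1) by (metis of_real_1 of_real_mult)
    have v: "\<i> * D * (cnj v - v) = T" unfolding D_def T_def v_def using \<Delta>
      by (simp add: field_simps)
    have \<tau>: "\<tau> = T + \<i> * U" unfolding T_def U_def by (rule complex_eq)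
    have w2': "w2 (br X Y) = - (w1 X * (w3 Y + cnj (w3 Y)) - w1 Y * (w3 X + cnj (w3 X))
       + k * (w1 X * cnj (w1 Y) - w1 Y * cnj (w1 X)))" for X Y
      using w2[of X Y] by (metis minus_minus)
    have w3': "w3 (br X Y) = - (\<tau> * (w1 X * cnj (w1 Y) - w1 Y * cnj (w1 X))
       + \<i> * D * (w1 X * cnj (w2 Y) - w1 Y * cnj (w2 X) - w2 X * cnj (w1 Y) + w2 Y * cnj (w1 X)))" for X Y
      using w3[of X Y] unfolding D_def by (metis minus_minus)
    show "base_eqs br ?w1 ?w2 ?w3 E S"
      unfolding base_eqs_def of_real_mult M_def[symmetric] R_def[symmetric] wedge_def conj_form_def
    proof (intro conjI allI)
      fix X Y
      show "M * w1 (br X Y) = 0" by (simp add: w1)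
      show "- (M * R * (w2 (br X Y) + v * w1 (br X Y))) =
          M * w1 X * (R * (w3 Y + cnj k * w1 Y)) - M * w1 Y * (R * (w3 X + cnj k * w1 X))
          + (M * w1 X * cnj (R * (w3 Y + cnj k * w1 Y)) - M * w1 Y * cnj (R * (w3 X + cnj k * w1 X)))"
        unfolding w1 w2' complex_cnj_mult complex_cnj_add complex_cnj_cnj cM cR by algebra
      show "- (R * (w3 (br X Y) + cnj k * w1 (br X Y))) =
          \<i> * of_real E * (M * w1 X * cnj (M * w1 Y) - M * w1 Y * cnj (M * w1 X))
          + \<i> * of_real S * (M * w1 X * cnj (M * R * (w2 Y + v * w1 Y)) - M * w1 Y * cnj (M * R * (w2 X + v * w1 X))
            - (M * R * (w2 X + v * w1 X) * cnj (M * w1 Y) - M * R * (w2 Y + v * w1 Y) * cnj (M * w1 X)))"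
        unfolding w1 w3' complex_cnj_mult complex_cnj_add complex_cnj_cnj cM cR \<tau>
        using MM RU SS v by algebra
    qed
  qed
qed

lemma ex_full_eqs:
  fixes br :: "'a::real_vector \<Rightarrow> 'a \<Rightarrow> 'a"
  assumes nil: "nilpotent_lie_algebra br" and cpx: "complex_structure br J" and wnn: "weakly_non_nilpotent br J"
    and dim: "dim (UNIV :: 'a set) = 8"
  obtains w1 w2 w3 w4 \<epsilon> \<delta> \<nu> a B where "coframe J w1 w2 w3 w4" "full_eqs br w1 w2 w3 w4 \<epsilon> \<delta> \<nu> a B"
    "\<epsilon> \<in> {0, 1}" "\<delta> \<in> {1, -1}"
proof -
  interpret nilpotent_cplx br J
    by unfold_locales (fact nil cpx)+
  obtain w1 w2 w3 w4 \<epsilon> \<delta> where cf: "coframe J w1 w2 w3 w4" and base: "base_eqs br w1 w2 w3 \<epsilon> \<delta>"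
    and \<epsilon>: "\<epsilon> \<in> {0, 1}" and \<delta>: "\<delta> \<in> {1, -1}"
    and central: "\<And>X Y. w1 X = 0 \<Longrightarrow> w2 X = 0 \<Longrightarrow> w3 X = 0 \<Longrightarrow> br X Y = 0"
    using ex_normalized_base[OF nil cpx wnn dim] by metis
  obtain a12 a13 a23 c11 c12 c13 c21 c22 c23 c31 c32 c33 where d4:
    "\<And>X Y. - w4 (br X Y) = a12 * wedge w1 w2 X Y + a13 * wedge w1 w3 X Y + a23 * wedge w2 w3 X Y
       + c11 * wedge w1 (conj_form w1) X Y + c12 * wedge w1 (conj_form w2) X Y + c13 * wedge w1 (conj_form w3) X Y
       + c21 * wedge w2 (conj_form w1) X Y + c22 * wedge w2 (conj_form w2) X Y + c23 * wedge w2 (conj_form w3) X Y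
       + c31 * wedge w3 (conj_form w1) X Y + c32 * wedge w3 (conj_form w2) X Y + c33 * wedge w3 (conj_form w3) X Y"
  proof (rule type_decomposition[OF dim cf _ coframe_forms(4)[OF cf]], goal_cases)
    case 1
    show ?case by (rule central[OF 1(2-)])
  next
    case 2
    show ?case by (rule 2(1)[OF 2(2)])
  qed
  have \<delta>0: "\<delta> \<noteq> 0" and \<delta>\<delta>: "of_real \<delta> * of_real \<delta> = (1 :: complex)" using \<delta> by auto
  note cl = closed_coefficients[OF nil dim cf base \<delta>0 d4]
  have ii: "\<i> * \<i> = (-1 :: complex)" by simp
  have c13: "c13 = a13 + 2 * of_real \<delta> * of_real \<epsilon> * a23"
    using cl(7) \<delta>\<delta> by algebra
  \<comment> \<open>With \<open>c21 = - c12\<close> the terms in \<open>c12\<close> and \<open>c21\<close> are \<open>z\<close> times the differential of \<open>w3\<close>, up to its \<open>\<epsilon>\<close>-term, which moves into \<open>B\<close>.\<close>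
  define z where "z = - \<i> * of_real \<delta> * c12"
  let ?w4 = "\<lambda>X. w4 X + (- a13 * w2 X + - z * w3 X)"
  note f = coframe_forms[OF cf]
  have "?w4 \<in> forms_1_0 J"
    by (intro forms_1_0_scale forms_1_0_add f)
  then have "coframe J w1 w2 w3 ?w4"
    using cf f unfolding coframe_def by auto
  moreover have "full_eqs br w1 w2 w3 ?w4 \<epsilon> \<delta> a23 a12 (c11 - \<i> * of_real \<epsilon> * z)"
    unfolding full_eqs_def
  proof (intro conjI allI base)
    fix X Y
    have "- w2 (br X Y) = wedge w1 w3 X Y + wedge w1 (conj_form w3) X Y"
      and "- w3 (br X Y) = \<i> * of_real \<epsilon> * wedge w1 (conj_form w1) X Y
        + \<i> * of_real \<delta> * (wedge w1 (conj_form w2) X Y - wedge w2 (conj_form w1) X Y)"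
      using base by (auto simp: base_eqs_def)
    then show "- (w4 (br X Y) + (- a13 * w2 (br X Y) + - z * w3 (br X Y))) =
        a12 * wedge w1 w2 X Y + (c11 - \<i> * of_real \<epsilon> * z) * wedge w1 (conj_form w1) X Y
        + a23 * (wedge w2 w3 X Y + 2 * of_real \<delta> * of_real \<epsilon> * wedge w1 (conj_form w3) X Y
             + wedge w2 (conj_form w3) X Y)"
      using d4[of X Y] cl(1-6) c13 z_def ii \<delta>\<delta> by algebra
  qed
  ultimately show ?thesis using that \<epsilon> \<delta> by blast
qed

lemma full_eqs_rescale:
  assumes eqs: "full_eqs br w1 w2 w3 w4 \<epsilon> \<delta> \<nu> a B"
    and u: "u * cnj u = 1" and r: "\<epsilon> = 0 \<or> r = 1"
    and \<nu>: "\<kappa> * \<nu> = \<nu>' * u * (of_real r)\<^sup>2" and a: "\<kappa> * a = a' * u\<^sup>2 * of_real r" and B: "B' = \<kappa> * B"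
  shows "full_eqs br (\<lambda>X. u * w1 X) (\<lambda>X. u * of_real r * w2 X) (\<lambda>X. of_real r * w3 X) (\<lambda>X. \<kappa> * w4 X) \<epsilon> \<delta> \<nu>' a' B'"
proof -
  define R E D where "R = complex_of_real r" and "E = complex_of_real \<epsilon>" and "D = complex_of_real \<delta>"
  have cR: "cnj R = R" by (simp add: R_def)
  have RE: "R * E = E" using r by (auto simp: R_def E_def)
  have w: "w1 (br X Y) = 0" "- w2 (br X Y) = wedge w1 w3 X Y + wedge w1 (conj_form w3) X Y"
    "- w3 (br X Y) = \<i> * E * wedge w1 (conj_form w1) X Y
        + \<i> * D * (wedge w1 (conj_form w2) X Y - wedge w2 (conj_form w1) X Y)"
    "- w4 (br X Y) = a * wedge w1 w2 X Y + B * wedge w1 (conj_form w1) X Y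
        + \<nu> * (wedge w2 w3 X Y + 2 * D * E * wedge w1 (conj_form w3) X Y
             + wedge w2 (conj_form w3) X Y)" for X Y
    using eqs by (auto simp: full_eqs_def base_eqs_def E_def D_def)
  note w = w[unfolded wedge_def conj_form_def]
  show ?thesis
    unfolding full_eqs_def base_eqs_def wedge_def conj_form_def R_def[symmetric] E_def[symmetric] D_def[symmetric]
      complex_cnj_mult cR
  proof (intro conjI allI)
    fix X Y
    show "u * w1 (br X Y) = 0" by (simp add: w)
    show "- (u * R * w2 (br X Y)) =
        u * w1 X * (R * w3 Y) - u * w1 Y * (R * w3 X)
        + (u * w1 X * (R * cnj (w3 Y)) - u * w1 Y * (R * cnj (w3 X)))"
      using w(2)[of X Y] by algebra
    show "- (R * w3 (br X Y)) =
        \<i> * E * (u * w1 X * (cnj u * cnj (w1 Y)) - u * w1 Y * (cnj u * cnj (w1 X)))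
        + \<i> * D * (u * w1 X * (cnj u * R * cnj (w2 Y)) - u * w1 Y * (cnj u * R * cnj (w2 X))
           - (u * R * w2 X * (cnj u * cnj (w1 Y)) - u * R * w2 Y * (cnj u * cnj (w1 X))))"
      using w(3)[of X Y] RE u by algebra
    show "- (\<kappa> * w4 (br X Y)) =
        a' * (u * w1 X * (u * R * w2 Y) - u * w1 Y * (u * R * w2 X))
        + B' * (u * w1 X * (cnj u * cnj (w1 Y)) - u * w1 Y * (cnj u * cnj (w1 X)))
        + \<nu>' * (u * R * w2 X * (R * w3 Y) - u * R * w2 Y * (R * w3 X)
           + 2 * D * E * (u * w1 X * (R * cnj (w3 Y)) - u * w1 Y * (R * cnj (w3 X)))
           + (u * R * w2 X * (R * cnj (w3 Y)) - u * R * w2 Y * (R * cnj (w3 X))))"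
      using w(4)[of X Y] RE u \<nu>[folded R_def] a[folded R_def] B by algebra
  qed
qed

lemma ex_unit_rotation:
  obtains u :: complex where "u * cnj u = 1" "u * z = of_real (cmod z)"
proof (cases "z = 0")
  case True
  then show ?thesis using that[of 1] by simp
next
  case False
  have "cnj z * z = of_real (cmod z) * of_real (cmod z)"
    by (metis complex_norm_square mult.commute of_real_mult power2_eq_square)
  then show ?thesis
    using that[of "cnj z / of_real (cmod z)"] False by (simp add: field_simps)
qed

text \<open>
  A rotation makes \<open>q\<close> real and nonnegative; if \<open>\<epsilon> = 0\<close>, a dilation is allowed as well and makes a
  nonzero \<open>q\<close> equal to 1. This is why \<open>B\<close> runs over \<open>{0, 1}\<close> in one case and over the half-line in the other.
\<close>

lemma ex_rotation_dilation:
  fixes q :: complex and \<epsilon> :: real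
  assumes "\<epsilon> \<in> {0, 1}"
  obtains u r b where "u * cnj u = 1" "r \<noteq> 0" "\<epsilon> = 0 \<or> r = 1" "u * (of_real r)\<^sup>2 * q = of_real b"
    "b \<ge> 0" "\<epsilon> = 0 \<Longrightarrow> b \<in> {0, 1}"
proof -
  obtain u where u: "u * cnj u = 1" "u * q = of_real (cmod q)"
    by (rule ex_unit_rotation)
  show ?thesis
  proof (cases "\<epsilon> = 0 \<and> q \<noteq> 0")
    case True
    have "u * (of_real (1 / sqrt (cmod q)))\<^sup>2 * q = (u * q) * of_real ((1 / sqrt (cmod q))\<^sup>2)"
      by simp
    also have "(1 / sqrt (cmod q))\<^sup>2 = 1 / cmod q"
      by (simp add: power_divide)
    also have "(u * q) * of_real (1 / cmod q) = of_real 1"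
      using True by (simp add: u(2))
    finally show ?thesis
      using True u(1) by (intro that[of u "1 / sqrt (cmod q)" 1]) auto
  next
    case False
    then show ?thesis
      using u assms by (intro that[of u 1 "cmod q"]) auto
  qed
qed

text \<open>
  The action of \<open>full_eqs_rescale\<close> brings every triple of parameters into the admissible list: \<open>\<kappa>\<close>
  makes \<open>\<nu>\<close> (or else \<open>a\<close>, or else \<open>B\<close>) equal to 1, and the rotation \<open>u\<close> makes the next nonzero
  parameter positive. If \<open>\<epsilon> = 0\<close>, the real factor \<open>r\<close> scales it to 1; its sign is still free
  when \<open>\<nu>\<close> and \<open>a\<close> are nonzero, and acts on \<open>B\<close> by \<open>-1\<close>.
\<close>

lemma normalize_parameters:
  fixes \<nu> a B :: complex
  assumes \<epsilon>: "\<epsilon> \<in> {0, 1}" and \<delta>: "\<delta> \<in> {1, -1}"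
  obtains u \<kappa> :: complex and r \<nu>' a' :: real where "u * cnj u = 1" "r \<noteq> 0" "\<kappa> \<noteq> 0" "\<epsilon> = 0 \<or> r = 1"
    "\<kappa> * \<nu> = of_real \<nu>' * u * (of_real r)\<^sup>2" "\<kappa> * a = of_real a' * u\<^sup>2 * of_real r"
    "admissible \<epsilon> \<delta> \<nu>' a' (\<kappa> * B)"
proof (cases "\<nu> = 0")
  case \<nu>: False
  show ?thesis
  proof (cases "a = 0")
    case True
    obtain u r b where u: "u * cnj u = 1" "r \<noteq> 0" "\<epsilon> = 0 \<or> r = 1" "u * (of_real r)\<^sup>2 * (B / \<nu>) = of_real b"
      "b \<ge> 0" "\<epsilon> = 0 \<Longrightarrow> b \<in> {0, 1}"
      using ex_rotation_dilation[OF \<epsilon>] by metis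
    have "u \<noteq> 0" using u(1) by auto
    moreover have "admissible \<epsilon> \<delta> 1 0 (u * (of_real r)\<^sup>2 / \<nu> * B)"
      using \<epsilon> \<delta> u(4,5,6) by (simp add: admissible_def)
    ultimately show ?thesis
      using \<nu> True u(1-3) by (intro that[of u r "u * (of_real r)\<^sup>2 / \<nu>" 1 0]) simp_all
  next
    case a: False
    obtain c where c: "c * cnj c = 1" "c * (a / \<nu>) = of_real (cmod (a / \<nu>))"
      by (rule ex_unit_rotation)
    define p where "p = cmod (a / \<nu>)"
    have p: "p > 0" using a \<nu> by (simp add: p_def)
    have a_eq: "a = cnj c * of_real p * \<nu>"
    proof -
      have "a = (c * cnj c) * a" by (simp add: c(1))
      also have "\<dots> = cnj c * (c * (a / \<nu>)) * \<nu>" using \<nu> by simp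
      finally show ?thesis by (simp only: c(2) p_def)
    qed
    show ?thesis
    proof (cases "\<epsilon> = 0")
      case True
      define w where "w = cnj c * of_real (1 / p\<^sup>2) * (B / \<nu>)"
      have "\<exists>s\<in>{1, -1 :: real}. of_real s * w \<in> \<real>\<^sub>\<ge>\<^sub>0 \<or> Im (of_real s * w) > 0"
        by (cases "Im w" "0 :: real" rule: linorder_cases; cases "Re w \<ge> 0")
           (auto simp: complex_nonneg_Reals_iff)
      then obtain s :: real where s: "s \<in> {1, -1}" "of_real s * w \<in> \<real>\<^sub>\<ge>\<^sub>0 \<or> Im (of_real s * w) > 0"
        by blast
      define \<kappa> where "\<kappa> = of_real s * cnj c * of_real (1 / p\<^sup>2) / \<nu>"
      have "\<kappa> * B = of_real s * w" by (simp add: \<kappa>_def w_def)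
      then have "admissible \<epsilon> \<delta> 1 1 (\<kappa> * B)"
        using True \<delta> s(2) by (simp add: admissible_def)
      moreover have "(of_real s * cnj c) * cnj (of_real s * cnj c) = 1"
        using s(1) c(1) by (auto simp: mult.commute)
      moreover have "\<kappa> * \<nu> = of_real 1 * (of_real s * cnj c) * (of_real (s / p))\<^sup>2"
        using \<nu> s(1) by (auto simp: \<kappa>_def power_divide)
      moreover have "\<kappa> * a = of_real 1 * (of_real s * cnj c)\<^sup>2 * of_real (s / p)"
        using \<nu> s(1) p by (auto simp: \<kappa>_def a_eq power2_eq_square)
      moreover have "\<kappa> \<noteq> 0" "s / p \<noteq> 0"
        using \<nu> s(1) p c(1) by (auto simp: \<kappa>_def)
      ultimately show ?thesis
        using True by (intro that[of "of_real s * cnj c" "s / p" \<kappa> 1 1]) blast+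
    next
      case False
      define \<kappa> where "\<kappa> = cnj c / \<nu>"
      have "admissible \<epsilon> \<delta> 1 p (\<kappa> * B)"
        using False \<epsilon> \<delta> p by (simp add: admissible_def)
      moreover have "\<kappa> * \<nu> = of_real 1 * cnj c * (of_real 1)\<^sup>2"
        using \<nu> by (simp add: \<kappa>_def)
      moreover have "\<kappa> * a = of_real p * (cnj c)\<^sup>2 * of_real 1"
        using \<nu> by (simp add: \<kappa>_def a_eq power2_eq_square)
      moreover have "cnj c * cnj (cnj c) = 1" using c(1) by (simp add: mult.commute)
      moreover have "\<kappa> \<noteq> 0" using \<nu> c(1) by (auto simp: \<kappa>_def)
      ultimately show ?thesis
        by (intro that[of "cnj c" 1 \<kappa> 1 p]) simp_all
    qed
  qed
next
  case \<nu>: True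
  show ?thesis
  proof (cases "a = 0")
    case True
    show ?thesis
    proof (cases "B = 0")
      case B: True
      have "admissible \<epsilon> \<delta> 0 0 (1 * B)"
        using \<epsilon> \<delta> B by (simp add: admissible_def)
      then show ?thesis
        using \<nu> True by (intro that[of 1 1 1 0 0]) simp_all
    next
      case B: False
      have "admissible \<epsilon> \<delta> 0 0 ((1 / B) * B)"
        using \<epsilon> \<delta> B by (simp add: admissible_def)
      then show ?thesis
        using \<nu> True B by (intro that[of 1 1 "1 / B" 0 0]) simp_all
    qed
  next
    case a: False
    obtain c t b where c: "c * cnj c = 1" "t \<noteq> 0" "\<epsilon> = 0 \<or> t = 1" "c * (of_real t)\<^sup>2 * (B / a) = of_real b"
      "b \<ge> 0" "\<epsilon> = 0 \<Longrightarrow> b \<in> {0, 1}"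
      using ex_rotation_dilation[OF \<epsilon>] by metis
    define u where "u = csqrt c"
    have "(cmod c)\<^sup>2 = 1"
      using c(1) by (metis complex_norm_square of_real_eq_1_iff)
    then have "cmod c = 1" using norm_ge_zero[of c] by (auto simp: power2_eq_1_iff)
    then have "cmod u = 1" by (simp add: u_def)
    then have u: "u * cnj u = 1"
      by (simp flip: complex_norm_square)
    define \<kappa> where "\<kappa> = u\<^sup>2 * of_real (t\<^sup>2) / a"
    have "\<kappa> * B = of_real b"
      using c(4) by (simp add: \<kappa>_def u_def)
    then have "admissible \<epsilon> \<delta> 0 1 (\<kappa> * B)"
      using \<epsilon> \<delta> c(5,6) by (simp add: admissible_def)
    moreover have "\<kappa> * a = of_real 1 * u\<^sup>2 * of_real (t\<^sup>2)"
      using a by (simp add: \<kappa>_def)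
    moreover have "\<kappa> \<noteq> 0" using u a c(2) by (auto simp: \<kappa>_def)
    ultimately show ?thesis
      using \<nu> u c(2,3) by (intro that[of u "t\<^sup>2" \<kappa> 0 1]) auto
  qed
qed

lemma ex_structure_equations:
  fixes br :: "'a::real_vector \<Rightarrow> 'a \<Rightarrow> 'a"
  assumes "nilpotent_lie_algebra br" "complex_structure br J" "weakly_non_nilpotent br J"
    and dim: "dim (UNIV :: 'a set) = 8"
  obtains \<omega> \<epsilon> \<delta> \<nu> a B where "coframe J (\<omega> 1) (\<omega> 2) (\<omega> 3) (\<omega> 4)" "admissible \<epsilon> \<delta> \<nu> a B"
    "structure_equations br \<omega> \<epsilon> \<delta> \<nu> a B"
proof -
  obtain w1 w2 w3 w4 \<epsilon> \<delta> \<nu> a B where cf: "coframe J w1 w2 w3 w4"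
    and eqs: "full_eqs br w1 w2 w3 w4 \<epsilon> \<delta> \<nu> a B" and \<epsilon>\<delta>: "\<epsilon> \<in> {0, 1}" "\<delta> \<in> {1, -1}"
    by (rule ex_full_eqs[OF assms])
  obtain u \<kappa> r \<nu>' a' where u: "u * cnj u = 1" "r \<noteq> 0" "\<kappa> \<noteq> 0" "\<epsilon> = 0 \<or> r = 1"
    "\<kappa> * \<nu> = of_real \<nu>' * u * (of_real r)\<^sup>2" "\<kappa> * a = of_real a' * u\<^sup>2 * of_real r"
    and adm: "admissible \<epsilon> \<delta> \<nu>' a' (\<kappa> * B)"
    by (rule normalize_parameters[OF \<epsilon>\<delta>, of \<nu> a B])
  define \<omega> where "\<omega> = (\<lambda>k::nat. if k = 1 then (\<lambda>X. u * w1 X) else if k = 2 then (\<lambda>X. u * of_real r * w2 X)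
    else if k = 3 then (\<lambda>X. of_real r * w3 X) else (\<lambda>X. \<kappa> * w4 X))"
  have \<omega>: "\<omega> 1 = (\<lambda>X. u * w1 X)" "\<omega> 2 = (\<lambda>X. u * of_real r * w2 X)" "\<omega> 3 = (\<lambda>X. of_real r * w3 X)"
      "\<omega> 4 = (\<lambda>X. \<kappa> * w4 X)"
    by (simp_all add: \<omega>_def)
  have "u \<noteq> 0" using u(1) by auto
  then have "coframe J (\<omega> 1) (\<omega> 2) (\<omega> 3) (\<omega> 4)"
    unfolding \<omega> using cf u(2,3) coframe_forms[OF cf] unfolding coframe_def by (auto simp: forms_1_0_scale)
  moreover have "structure_equations br \<omega> \<epsilon> \<delta> \<nu>' a' (\<kappa> * B)"
    unfolding structure_equations_iff \<omega> by (rule full_eqs_rescale[OF eqs u(1,4,5,6) refl])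
  ultimately show ?thesis using adm that by blast
qed

section \<open>The algebras defined by the equations\<close>

lemma ex_bracket_full_eqs:
  fixes J :: "'a::real_vector \<Rightarrow> 'a"
  assumes dim: "dim (UNIV :: 'a set) = 8" and cf: "coframe J w1 w2 w3 w4"
  obtains br where "full_eqs br w1 w2 w3 w4 \<epsilon> \<delta> \<nu> a B"
proof -
  have "\<exists>Z. w1 Z = 0 \<and> - w2 Z = wedge w1 w3 X Y + wedge w1 (conj_form w3) X Y \<and>
     - w3 Z = \<i> * of_real \<epsilon> * wedge w1 (conj_form w1) X Y
        + \<i> * of_real \<delta> * (wedge w1 (conj_form w2) X Y - wedge w2 (conj_form w1) X Y) \<and>
     - w4 Z = a * wedge w1 w2 X Y + B * wedge w1 (conj_form w1) X Y
        + \<nu> * (wedge w2 w3 X Y + 2 * of_real \<delta> * of_real \<epsilon> * wedge w1 (conj_form w3) X Y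
             + wedge w2 (conj_form w3) X Y)" for X Y
  proof -
    have "\<exists>Z. w1 Z = z1 \<and> - w2 Z = z2 \<and> - w3 Z = z3 \<and> - w4 Z = z4" for z1 z2 z3 z4
      by (rule coframe_surj[OF dim cf, of z1 "- z2" "- z3" "- z4"]) auto
    then show ?thesis .
  qed
  then show ?thesis
    using that unfolding full_eqs_def base_eqs_def by metis
qed

locale full_eqs_algebra =
  fixes br :: "'a::real_vector \<Rightarrow> 'a \<Rightarrow> 'a" and J :: "'a \<Rightarrow> 'a" and w1 w2 w3 w4 :: "'a form"
    and \<epsilon> \<delta> :: real and \<nu> a B :: complex
  assumes J: "linear J" "\<And>X. J (J X) = - X" and dim: "dim (UNIV :: 'a set) = 8"
    and cf: "coframe J w1 w2 w3 w4" and eqs: "full_eqs br w1 w2 w3 w4 \<epsilon> \<delta> \<nu> a B"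
    and \<delta>: "\<delta> \<in> {1, -1}"
begin

lemma br1: "w1 (br X Y) = 0"
  using eqs by (simp add: full_eqs_def base_eqs_def)

lemma br2: "w2 (br X Y) = - (w1 X * w3 Y - w1 Y * w3 X + (w1 X * cnj (w3 Y) - w1 Y * cnj (w3 X)))"
  using eqs unfolding full_eqs_def base_eqs_def wedge_def conj_form_def by (metis minus_minus)

lemma br3: "w3 (br X Y) = - (\<i> * of_real \<epsilon> * (w1 X * cnj (w1 Y) - w1 Y * cnj (w1 X))
    + \<i> * of_real \<delta> * (w1 X * cnj (w2 Y) - w1 Y * cnj (w2 X) - (w2 X * cnj (w1 Y) - w2 Y * cnj (w1 X))))"
  using eqs unfolding full_eqs_def base_eqs_def wedge_def conj_form_def by (metis minus_minus)

lemma br4: "w4 (br X Y) = - (a * (w1 X * w2 Y - w1 Y * w2 X) + B * (w1 X * cnj (w1 Y) - w1 Y * cnj (w1 X))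
    + \<nu> * (w2 X * w3 Y - w2 Y * w3 X + 2 * of_real \<delta> * of_real \<epsilon> * (w1 X * cnj (w3 Y) - w1 Y * cnj (w3 X))
      + (w2 X * cnj (w3 Y) - w2 Y * cnj (w3 X))))"
  using eqs unfolding full_eqs_def base_eqs_def wedge_def conj_form_def by (metis minus_minus)

lemmas br_eqs = br1 br2 br3 br4

lemmas coframe_apply = coframe_forms[OF cf, THEN forms_1_0_apply(1)] coframe_forms[OF cf, THEN forms_1_0_apply(2)]
  coframe_forms[OF cf, THEN forms_1_0_apply(3)] coframe_forms[OF cf, THEN forms_1_0_apply(4)]
  coframe_forms[OF cf, THEN forms_1_0_apply(5)] coframe_forms[OF cf, THEN forms_1_0_apply(6)]

lemmas cnj_simps = complex_cnj_mult complex_cnj_cnj complex_cnj_add complex_cnj_diff complex_cnj_minus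
  complex_cnj_complex_of_real complex_cnj_i complex_cnj_numeral

lemma bilinear: "bilinear br"
  unfolding bilinear_def
proof (intro conjI allI linearI)
  fix X Y Z and r :: real
  show "br X (Y + Z) = br X Y + br X Z"
    by (rule coframe_eqI[OF cf]; unfold coframe_apply br_eqs cnj_simps; algebra)
  show "br X (r *\<^sub>R Y) = r *\<^sub>R br X Y"
    by (rule coframe_eqI[OF cf]; unfold coframe_apply br_eqs cnj_simps; algebra)
  show "br (Y + Z) X = br Y X + br Z X"
    by (rule coframe_eqI[OF cf]; unfold coframe_apply br_eqs cnj_simps; algebra)
  show "br (r *\<^sub>R Y) X = r *\<^sub>R br Y X"
    by (rule coframe_eqI[OF cf]; unfold coframe_apply br_eqs cnj_simps; algebra)
qed

text \<open>
  This is where \<open>\<delta>\<^sup>2 = 1\<close> matters: the form that \<open>\<nu>\<close> multiplies is closed because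
  the coefficient \<open>2 \<delta> \<epsilon>\<close> equals \<open>2 \<epsilon> / \<delta>\<close>.
\<close>

lemma jacobi: "br X (br Y Z) + br Y (br Z X) + br Z (br X Y) = 0"
proof (rule coframe_eqI[OF cf])
  have ii: "\<i> * \<i> = (-1 :: complex)" by simp
  have dd: "of_real \<delta> * of_real \<delta> = (1 :: complex)" using \<delta> by auto
  show "w1 (br X (br Y Z) + br Y (br Z X) + br Z (br X Y)) = w1 0"
    by (simp add: coframe_apply br1)
  show "w2 (br X (br Y Z) + br Y (br Z X) + br Z (br X Y)) = w2 0"
    unfolding coframe_apply br_eqs cnj_simps complex_cnj_zero by algebra
  show "w3 (br X (br Y Z) + br Y (br Z X) + br Z (br X Y)) = w3 0"
    unfolding coframe_apply br_eqs cnj_simps complex_cnj_zero by algebra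
  show "w4 (br X (br Y Z) + br Y (br Z X) + br Z (br X Y)) = w4 0"
    unfolding coframe_apply br_eqs cnj_simps complex_cnj_zero using ii dd by algebra
qed

lemma lie_algebra: "lie_algebra br"
proof -
  have "br X X = 0" for X
    by (rule coframe_eqI[OF cf]; unfold coframe_apply br_eqs; (rule refl | algebra))
  then show ?thesis
    using bilinear jacobi by (simp add: lie_algebra_def)
qed

lemma complex_structure: "complex_structure br J"
proof -
  have "br X Y + J (br (J X) Y) + J (br X (J Y)) - br (J X) (J Y) = 0" for X Y
  proof -
    have ii: "\<i> * \<i> = (-1 :: complex)" by simp
    show ?thesis
      by (rule coframe_eqI[OF cf]; unfold coframe_apply br_eqs cnj_simps; (use ii in algebra)?; simp)
  qed
  then show ?thesis using J by (simp add: complex_structure_def)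
qed

lemma br_central: "w1 X = 0 \<Longrightarrow> w2 X = 0 \<Longrightarrow> w3 X = 0 \<Longrightarrow> br X Y = 0"
  by (rule coframe_eqI[OF cf]) (simp_all add: coframe_apply br_eqs)

lemma br_central': "w1 X = 0 \<Longrightarrow> w2 X = 0 \<Longrightarrow> w3 X = 0 \<Longrightarrow> br Y X = 0"
  by (rule coframe_eqI[OF cf]) (simp_all add: coframe_apply br_eqs)

text \<open>
  The lower central series descends through the conditions \<open>w1 = 0\<close>, then \<open>Re w3 = 0\<close>, then \<open>w2 = 0\<close>, then
  \<open>Im w3 = 0\<close>: each of these coordinates has a differential in the ideal of the preceding ones.
\<close>

lemma nilpotent: "nilpotent_lie_algebra br"
proof -
  have step: "lower_central br (Suc k) \<subseteq> T"
    if "lower_central br k \<subseteq> S" "subspace T" "\<And>X Y. Y \<in> S \<Longrightarrow> br X Y \<in> T" for k S T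
    unfolding lower_central.simps by (rule span_minimal) (use that in blast)+
  have scale_zero: "of_real r * z + cnj (of_real r * z) = 0" if "z + cnj z = 0" for r z
    using that by (simp flip: distrib_left)
  have add_zero: "(y + z) + cnj (y + z) = 0" if "y + cnj y = 0" "z + cnj z = 0" for y z :: complex
    unfolding complex_cnj_add using that by algebra
  have re3: "w3 (br X Y) + cnj (w3 (br X Y)) = 0" if "w1 Y = 0" for X Y
    unfolding br_eqs cnj_simps complex_cnj_zero that by algebra
  have l1: "lower_central br 1 \<subseteq> {X. w1 X = 0}"
    unfolding One_nat_def by (rule step[of 0 UNIV]) (auto simp: subspace_def coframe_apply br1)
  have l2: "lower_central br (Suc 1) \<subseteq> {X. w1 X = 0 \<and> w3 X + cnj (w3 X) = 0}"
  proof (rule step[OF l1])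
    show "subspace {X. w1 X = 0 \<and> w3 X + cnj (w3 X) = 0}"
      unfolding subspace_def by (simp add: coframe_apply scale_zero add_zero del: complex_cnj_add complex_cnj_mult)
  qed (simp add: br1 re3)
  have l3: "lower_central br (Suc (Suc 1)) \<subseteq> {X. w1 X = 0 \<and> w2 X = 0 \<and> w3 X + cnj (w3 X) = 0}"
  proof (rule step[OF l2])
    show "subspace {X. w1 X = 0 \<and> w2 X = 0 \<and> w3 X + cnj (w3 X) = 0}"
      unfolding subspace_def by (simp add: coframe_apply scale_zero add_zero del: complex_cnj_add complex_cnj_mult)
    have "w2 (br X Y) = 0" if "w1 Y = 0" "w3 Y + cnj (w3 Y) = 0" for X Y
      unfolding br2 that(1) using that(2) by algebra
    then show "\<And>X Y. Y \<in> {X. w1 X = 0 \<and> w3 X + cnj (w3 X) = 0} \<Longrightarrow>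
      br X Y \<in> {X. w1 X = 0 \<and> w2 X = 0 \<and> w3 X + cnj (w3 X) = 0}"
      by (simp add: br1 re3)
  qed
  have l4: "lower_central br (Suc (Suc (Suc 1))) \<subseteq> {X. w1 X = 0 \<and> w2 X = 0 \<and> w3 X = 0}"
  proof (rule step[OF l3])
    show "subspace {X. w1 X = 0 \<and> w2 X = 0 \<and> w3 X = 0}"
      unfolding subspace_def by (simp add: coframe_apply)
    have "w2 (br X Y) = 0" if "w1 Y = 0" "w3 Y + cnj (w3 Y) = 0" for X Y
      unfolding br2 that(1) using that(2) by algebra
    then show "\<And>X Y. Y \<in> {X. w1 X = 0 \<and> w2 X = 0 \<and> w3 X + cnj (w3 X) = 0} \<Longrightarrow>
      br X Y \<in> {X. w1 X = 0 \<and> w2 X = 0 \<and> w3 X = 0}"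
      by (simp add: br1 br3)
  qed
  have "lower_central br (Suc (Suc (Suc (Suc 1)))) \<subseteq> {0}"
    by (rule step[OF l4]) (use br_central' in auto)
  moreover have "0 \<in> lower_central br (Suc (Suc (Suc (Suc 1))))"
    unfolding lower_central.simps(2) by (rule span_zero)
  ultimately have "lower_central br (Suc (Suc (Suc (Suc 1)))) = {0}" by blast
  then show ?thesis
    unfolding nilpotent_lie_algebra_def using lie_algebra by blast
qed

text \<open>
  From index 1 on the compatible series equals the common kernel of \<open>w1\<close>, \<open>w2\<close>, \<open>w3\<close>: modulo this
  kernel the only real central direction is the imaginary direction of \<open>w3\<close>, which is not \<open>J\<close>-invariant.
\<close>

lemma weakly_non_nilpotent: "weakly_non_nilpotent br J"
proof -
  let ?P = "{X. w1 X = 0 \<and> w2 X = 0 \<and> w3 X = 0}"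
  have P: "X \<in> ?P" if 1: "\<And>Y. br X Y \<in> ?P" and 2: "\<And>Y. br (J X) Y \<in> ?P" for X
  proof -
    obtain e1 where e1: "w1 e1 = 1" "w2 e1 = 0" "w3 e1 = 0" "w4 e1 = 0" by (rule coframe_surj[OF dim cf])
    obtain e3 where e3: "w1 e3 = 0" "w2 e3 = 0" "w3 e3 = 1" "w4 e3 = 0" by (rule coframe_surj[OF dim cf])
    have w1: "w1 X = 0"
      using 1[of e3] by (simp add: br2 e3)
    have "Re (w3 X) = 0" "Im (w3 X) = 0"
      using 1[of e1] 2[of e1] by (simp_all add: br2 e1 coframe_apply complex_eq_iff)
    then have w3: "w3 X = 0" by (simp add: complex_eq_iff)
    have "w2 X + cnj (w2 X) = 0" "w2 X - cnj (w2 X) = 0"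
      using 1[of e1] 2[of e1] \<delta> by (auto simp: br3 e1 coframe_apply w1 complex_eq_iff)
    then have "w2 X = 0" by simp
    with w1 w3 show ?thesis by simp
  qed
  have zero: "br X Y = 0" "br (J X) Y = 0" if "X \<in> ?P" for X Y
    using that by (auto intro!: br_central simp: coframe_apply)
  have step: "{X. (\<forall>Y. br X Y \<in> S) \<and> (\<forall>Y. br (J X) Y \<in> S)} = ?P" if S: "0 \<in> S" "S \<subseteq> ?P" for S
  proof (intro set_eqI iffI)
    fix X assume X: "X \<in> {X. (\<forall>Y. br X Y \<in> S) \<and> (\<forall>Y. br (J X) Y \<in> S)}"
    show "X \<in> ?P"
      by (rule P; rule subsetD[OF S(2)]; use X in simp)
  next
    fix X assume X: "X \<in> ?P"
    show "X \<in> {X. (\<forall>Y. br X Y \<in> S) \<and> (\<forall>Y. br (J X) Y \<in> S)}"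
      unfolding mem_Collect_eq zero[OF X] using S(1) by blast
  qed
  have P0: "0 \<in> ?P" by (simp add: coframe_apply)
  have compat: "compat_series br J (Suc k) = ?P" for k
  proof (induction k)
    case 0
    show ?case
      unfolding compat_series.simps by (rule step) (simp_all add: coframe_apply)
  next
    case (Suc k)
    show ?case
      unfolding compat_series.simps(2)[of br J "Suc k"] Suc by (rule step[OF P0]) blast
  qed
  obtain X1 where X1: "w1 X1 = 1" "w2 X1 = 0" "w3 X1 = 0" "w4 X1 = 0" by (rule coframe_surj[OF dim cf])
  obtain X4 where X4: "w1 X4 = 0" "w2 X4 = 0" "w3 X4 = 0" "w4 X4 = 1" by (rule coframe_surj[OF dim cf])
  have "X4 \<in> ?P" "X4 \<noteq> 0" using X4 by (auto simp: coframe_apply)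
  then have "compat_series br J 1 \<noteq> {0}"
    unfolding One_nat_def compat by blast
  moreover have "X1 \<notin> ?P" using X1 by simp
  then have "compat_series br J 1 \<noteq> UNIV"
    unfolding One_nat_def compat by blast
  moreover have "compat_series br J 1 = compat_series br J (1 + l)" for l
    using compat[of 0] compat[of l] by (simp only: One_nat_def plus_nat.simps)
  ultimately show ?thesis
    unfolding weakly_non_nilpotent_def by (metis zero_less_one)
qed

end

section \<open>Inequivalence\<close>

lemma coframe_pullback:
  assumes "linear f" "bij f" "f \<circ> J = J' \<circ> f" "coframe J' v1 v2 v3 v4"
  shows "coframe J (v1 \<circ> f) (v2 \<circ> f) (v3 \<circ> f) (v4 \<circ> f)"
proof -
  have "v \<circ> f \<in> forms_1_0 J" if "v \<in> forms_1_0 J'" for v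
    using that assms(1,3) by (auto simp: forms_1_0_def fun_eq_iff intro: linear_compose)
  moreover have "X = 0" if "f X = 0" for X
    using that assms(1,2) by (metis bij_is_inj injD linear_0)
  ultimately show ?thesis
    using assms(4) by (auto simp: coframe_def)
qed

lemma full_eqs_pullback:
  assumes "\<And>X Y. f (br X Y) = br' (f X) (f Y)" "full_eqs br' v1 v2 v3 v4 \<epsilon> \<delta> \<nu> a B"
  shows "full_eqs br (v1 \<circ> f) (v2 \<circ> f) (v3 \<circ> f) (v4 \<circ> f) \<epsilon> \<delta> \<nu> a B"
  using assms by (simp add: full_eqs_def base_eqs_def wedge_def conj_form_def)

text \<open>
  Two admissible triples in the same orbit coincide. For \<open>\<nu> = 1\<close> the equations give \<open>\<kappa> = u r\<^sup>2\<close> and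
  \<open>r a = a' u\<close>. So for nonzero \<open>a\<close> the rotation \<open>u\<close> is a sign. It is 1 if \<open>\<epsilon> = 1\<close>; if \<open>\<epsilon> = 0\<close>, it
  equals \<open>r\<close> and acts on \<open>B\<close>, and the conditions on \<open>B\<close> single out one of \<open>B\<close> and \<open>- B\<close>. In the
  other cases \<open>B\<close> is determined by its modulus, or by whether it vanishes.
\<close>

lemma normal_form_unique:
  fixes u \<kappa> B B' :: complex and r :: real
  assumes adm: "admissible \<epsilon> \<delta> \<nu> a B" and adm': "admissible \<epsilon> \<delta> \<nu>' a' B'"
    and u: "u * cnj u = 1" and r: "r \<noteq> 0" and \<kappa>: "\<kappa> \<noteq> 0" and \<epsilon>: "\<epsilon> = 0 \<or> r = 1"
    and \<nu>: "\<kappa> * of_real \<nu> = of_real \<nu>' * u * (of_real r)\<^sup>2"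
    and a: "\<kappa> * of_real a = of_real a' * u\<^sup>2 * of_real r"
    and B: "\<kappa> * B = B'"
  shows "(\<nu>, a, B) = (\<nu>', a', B')"
proof -
  have u0: "u \<noteq> 0" using u by auto
  have "(cmod u)\<^sup>2 = 1"
    using u by (metis complex_norm_square of_real_eq_1_iff)
  then have nu: "cmod u = 1" using norm_ge_zero[of u] by (auto simp: power2_eq_1_iff)
  have \<nu>01: "\<nu> \<in> {0, 1}" "\<nu>' \<in> {0, 1}" using adm adm' by (auto simp: admissible_def)
  have "\<nu> = 0 \<longleftrightarrow> \<nu>' = 0" using \<nu> \<kappa> u0 r by auto
  with \<nu>01 have \<nu>': "\<nu>' = \<nu>" by auto
  have a0: "a = 0 \<longleftrightarrow> a' = 0" using a \<kappa> u0 r by auto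
  have B0: "B = 0 \<longleftrightarrow> B' = 0" using B \<kappa> by auto
  have nonneg_eq: "B' = B" if "B \<in> \<real>\<^sub>\<ge>\<^sub>0" "B' \<in> \<real>\<^sub>\<ge>\<^sub>0" "cmod \<kappa> = 1"
  proof -
    obtain b b' where b: "B = of_real b" "b \<ge> 0" "B' = of_real b'" "b' \<ge> 0"
      using \<open>B \<in> \<real>\<^sub>\<ge>\<^sub>0\<close> \<open>B' \<in> \<real>\<^sub>\<ge>\<^sub>0\<close> by (auto elim!: nonneg_Reals_cases)
    have "cmod B' = cmod B" using B that(3) by (auto simp: norm_mult)
    then show ?thesis using b by simp
  qed
  have "a = a' \<and> B = B'"
  proof (cases "\<nu> = 1")
    case True
    then have \<kappa>u: "\<kappa> = u * (of_real r)\<^sup>2" using \<nu> \<nu>' by simp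
    show ?thesis
    proof (cases "a = 0")
      case a: True
      then have a': "a' = 0" using a0 by simp
      have "B \<in> \<real>\<^sub>\<ge>\<^sub>0" "B' \<in> \<real>\<^sub>\<ge>\<^sub>0" "\<epsilon> = 0 \<longrightarrow> B \<in> {0, 1} \<and> B' \<in> {0, 1}"
        using adm adm' a a' True \<nu>' by (auto simp: admissible_def)
      moreover have "cmod \<kappa> = 1" if "\<epsilon> \<noteq> 0"
        using that \<epsilon> nu by (simp add: \<kappa>u)
      ultimately show ?thesis
        using nonneg_eq B0 a a' by (cases "\<epsilon> = 0") auto
    next
      case a: False
      then have a': "a' \<noteq> 0" using a0 by simp
      have pos: "a > 0" "a' > 0" "\<epsilon> = 0 \<longrightarrow> a = 1 \<and> a' = 1"
        and half: "\<epsilon> = 0 \<longrightarrow> (B \<in> \<real>\<^sub>\<ge>\<^sub>0 \<or> Im B > 0) \<and> (B' \<in> \<real>\<^sub>\<ge>\<^sub>0 \<or> Im B' > 0)"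
        using adm adm' a a' True \<nu>' by (auto simp: admissible_def)
      have "(u * of_real r) * (of_real r * of_real a) = (u * of_real r) * (of_real a' * u)"
        using \<open>\<kappa> * of_real a = of_real a' * u\<^sup>2 * of_real r\<close>
        by (simp add: \<kappa>u power2_eq_square mult_ac)
      then have ra: "of_real (r * a) = of_real a' * u"
        using u0 r by simp
      show ?thesis
      proof (cases "\<epsilon> = 0")
        case True
        then have ur: "u = of_real r" using ra pos(3) by simp
        then have "r = 1 \<or> r = - 1" using nu by auto
        then have "\<kappa> = 1 \<or> \<kappa> = - 1" by (auto simp: \<kappa>u ur)
        then have "B' = B \<or> B' = - B" using B by auto
        then have "B' = B"
          using half True by (auto simp: complex_nonneg_Reals_iff complex_eq_iff)
        then show ?thesis using True pos(3) by simp
      next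
        case False
        then have r1: "r = 1" using \<epsilon> by simp
        have "cmod (of_real (r * a)) = cmod (of_real a' * u)" by (simp only: ra)
        then have aa: "a = a'" using r1 nu pos by (simp add: norm_mult)
        then have "u = 1" using ra r1 pos by simp
        then show ?thesis using aa B by (simp add: \<kappa>u r1)
      qed
    qed
  next
    case False
    then have \<nu>0: "\<nu> = 0" "\<nu>' = 0" using \<nu>01 \<nu>' by auto
    show ?thesis
    proof (cases "a = 0")
      case a: True
      then have a': "a' = 0" using a0 by simp
      have "B \<in> {0, 1}" "B' \<in> {0, 1}"
        using adm adm' a a' \<nu>0 by (auto simp: admissible_def)
      then show ?thesis using B0 a a' by auto
    next
      case a: False
      then have a': "a' \<noteq> 0" using a0 by simp
      have h: "a = 1" "a' = 1" "B \<in> \<real>\<^sub>\<ge>\<^sub>0" "B' \<in> \<real>\<^sub>\<ge>\<^sub>0" "\<epsilon> = 0 \<longrightarrow> B \<in> {0, 1} \<and> B' \<in> {0, 1}"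
        using adm adm' a a' \<nu>0 by (auto simp: admissible_def)
      moreover have "cmod \<kappa> = 1" if "\<epsilon> \<noteq> 0"
        using \<open>\<kappa> * of_real a = of_real a' * u\<^sup>2 * of_real r\<close> that \<epsilon> nu h(1,2)
        by (simp add: norm_power)
      ultimately show ?thesis
        using nonneg_eq B0 by (cases "\<epsilon> = 0") auto
    qed
  qed
  then show ?thesis using \<nu>' by simp
qed

text \<open>
  Comparing coefficients shows that any two coframes with structure equations of the given shape
  differ, as far as the parameters can see, by \<open>full_eqs_rescale\<close>. Evaluating an equation at \<open>(e\<^sub>j, e\<^sub>k)\<close>
  and \<open>(e\<^sub>j, J e\<^sub>k)\<close> separates the coefficients of type (2,0) and (1,1) for the pair \<open>j, k\<close>; this is
  the reason for the pairs of instances below.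
\<close>

lemma (in full_eqs_algebra) change_of_coframe:
  assumes cf': "coframe J v1 v2 v3 v4" and eqs': "full_eqs br v1 v2 v3 v4 \<epsilon>' \<delta>' \<nu>' a' B'"
    and \<delta>': "\<delta>' \<in> {1, -1}" and \<epsilon>: "\<epsilon> \<in> {0, 1}" and \<epsilon>': "\<epsilon>' \<in> {0, 1}"
  obtains u \<kappa> r where "\<epsilon>' = \<epsilon>" "\<delta>' = \<delta>" "u * cnj u = 1" "r \<noteq> 0" "\<kappa> \<noteq> 0" "\<epsilon> = 0 \<or> r = 1"
    "\<kappa> * \<nu> = \<nu>' * u * (of_real r)\<^sup>2" "\<kappa> * a = a' * u\<^sup>2 * of_real r" "\<kappa> * B = B'"
proof -
  interpret v: full_eqs_algebra br J v1 v2 v3 v4 \<epsilon>' \<delta>' \<nu>' a' B'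
    by (rule full_eqs_algebra.intro) (fact J dim cf' eqs' \<delta>')+
  note f' = coframe_forms[OF cf']
  obtain m11 m12 m13 m14 where v1: "\<And>X. v1 X = m11 * w1 X + m12 * w2 X + m13 * w3 X + m14 * w4 X"
    using coframe_spans[OF dim cf f'(1)] by metis
  obtain m21 m22 m23 m24 where v2: "\<And>X. v2 X = m21 * w1 X + m22 * w2 X + m23 * w3 X + m24 * w4 X"
    using coframe_spans[OF dim cf f'(2)] by metis
  obtain m31 m32 m33 m34 where v3: "\<And>X. v3 X = m31 * w1 X + m32 * w2 X + m33 * w3 X + m34 * w4 X"
    using coframe_spans[OF dim cf f'(3)] by metis
  obtain m41 m42 m43 m44 where v4: "\<And>X. v4 X = m41 * w1 X + m42 * w2 X + m43 * w3 X + m44 * w4 X"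
    using coframe_spans[OF dim cf f'(4)] by metis
  obtain e1 where e1: "w1 e1 = 1" "w2 e1 = 0" "w3 e1 = 0" "w4 e1 = 0" by (rule coframe_surj[OF dim cf])
  obtain e2 where e2: "w1 e2 = 0" "w2 e2 = 1" "w3 e2 = 0" "w4 e2 = 0" by (rule coframe_surj[OF dim cf])
  obtain e3 where e3: "w1 e3 = 0" "w2 e3 = 0" "w3 e3 = 1" "w4 e3 = 0" by (rule coframe_surj[OF dim cf])
  obtain e4 where e4: "w1 e4 = 0" "w2 e4 = 0" "w3 e4 = 0" "w4 e4 = 1" by (rule coframe_surj[OF dim cf])
  have ii: "\<i> * \<i> = (-1 :: complex)" by simp
  have dd: "of_real \<delta> * of_real \<delta> = (1 :: complex)" using \<delta> by auto
  have dd': "of_real \<delta>' * of_real \<delta>' = (1 :: complex)" using \<delta>' by auto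
  note ev = br_eqs coframe_apply e1 e2 e3 e4 cnj_simps complex_cnj_zero complex_cnj_one

  note E1 = v.br1[unfolded v1]
  have m12: "m12 = 0"
    using E1[of e1 e3] E1[of e1 "J e3"] ii unfolding ev by algebra
  have m13: "m13 = 0"
    using E1[of e1 e2] E1[of e1 "J e2"] ii dd unfolding ev by algebra
  have m14\<nu>: "m14 * \<nu> = 0"
    using E1[of e2 e3] E1[of e2 "J e3"] ii unfolding ev by algebra
  have m14a: "m14 * a = 0"
    using E1[of e1 e2] E1[of e1 "J e2"] ii m13 unfolding ev by algebra
  have m14B: "m14 * B = 0"
    using E1[of e1 "J e1"] ii m13 unfolding ev by algebra
  have real0: "z = 0" if "z + cnj z = 0" "\<i> * z + cnj (\<i> * z) = 0" for z
    using that by (simp add: complex_eq_iff)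
  note E2 = v.br2
  \<comment> \<open>If \<open>\<nu> = a = B = 0\<close>, then \<open>w4\<close> is closed too, and \<open>v1\<close> could a priori involve it. The second equation for \<open>v1\<close> at the central vectors \<open>e4\<close> and \<open>J e4\<close> would then make \<open>v3\<close> purely imaginary, hence zero.\<close>
  have m14: "m14 = 0"
  proof (rule ccontr)
    assume "m14 \<noteq> 0"
    have "v3 Y + cnj (v3 Y) = 0" for Y
    proof -
      have "br e4 X = 0" "br (J e4) X = 0" for X
        by (rule br_central; simp add: ev)+
      then have *: "v2 (br e4 X) = 0" "v2 (br (J e4) X) = 0" for X
        by (simp_all add: v.coframe_apply)
      have "m14 * cnj (v3 e4) = 0"
        using *(1)[of "J e4"] ii unfolding E2 v.coframe_apply cnj_simps unfolding v1 ev by algebra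
      then have "v3 e4 = 0" using \<open>m14 \<noteq> 0\<close> by simp
      then have "m14 * (v3 Y + cnj (v3 Y)) = 0"
        using *(1)[of Y] unfolding E2 v1 ev \<open>v3 e4 = 0\<close> by algebra
      then show ?thesis using \<open>m14 \<noteq> 0\<close> by simp
    qed
    then have "v3 Y = 0" for Y
      using real0[of "v3 Y"] by (metis v.coframe_apply(23))
    moreover obtain Y where "v3 Y = 1" by (rule coframe_surj[OF dim cf'])
    ultimately show False by simp
  qed
  have v1': "v1 X = m11 * w1 X" for X
    using v1[of X] by (simp add: m12 m13 m14)
  have m11: "m11 \<noteq> 0"
  proof
    assume "m11 = 0"
    moreover obtain Y where "v1 Y = 1" by (rule coframe_surj[OF dim cf'])
    ultimately show False using v1'[of Y] by simp
  qed
  define c where "c = cnj m11"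
  have c: "c \<noteq> 0" using m11 by (simp add: c_def)

  note E2 = v.br2[unfolded v2 v1' v3]
  have "m11 * (m34 + cnj m34) = 0" "m11 * (\<i> * m34 + cnj (\<i> * m34)) = 0"
    using E2[of e4 e1] E2[of "J e4" e1] unfolding ev by algebra+
  then have m34: "m34 = 0" using real0 m11 by simp
  have m23: "m23 = 0"
    using E2[of e2 e1] E2[of "J e2" e1] E2[of e2 "J e1"] E2[of "J e2" "J e1"] ii dd unfolding ev by algebra
  have "m11 * cnj m32 = 0"
    using E2[of e1 e2] E2[of e1 "J e2"] ii m23 unfolding ev by algebra
  then have m32: "m32 = 0" using m11 by simp
  have m24\<nu>: "m24 * \<nu> = 0"
    using E2[of e2 e3] E2[of e2 "J e3"] ii unfolding ev by algebra
  have m22: "m22 = m11 * m33"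
    using E2[of e1 e3] E2[of e1 "J e3"] ii unfolding ev by algebra
  have "m11 * (m33 - cnj m33) = 0"
    using E2[of e1 e3] E2[of e1 "J e3"] ii m24\<nu> unfolding ev by algebra
  then have m33: "cnj m33 = m33" using m11 by simp
  have m31B: "m24 * B = m11 * cnj m31"
    using E2[of e1 "J e1"] ii m23 unfolding ev by algebra

  note E3 = v.br3[unfolded v2 v1' v3]
  have "m11 * cnj m24 = 0"
    using E3[of e1 e4] E3[of e1 "J e4"] ii dd' unfolding ev by algebra
  then have m24: "m24 = 0" using m11 by simp
  have m31: "m31 = 0" using m31B m24 m11 by simp
  have v3': "v3 X = m33 * w3 X" for X
    using v3[of X] by (simp add: m31 m32 m34)
  have m33_nz: "m33 \<noteq> 0"
  proof
    assume "m33 = 0"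
    moreover obtain Y where "v3 Y = 1" by (rule coframe_surj[OF dim cf'])
    ultimately show False using v3'[of Y] by simp
  qed
  have cm22: "cnj m22 = cnj m11 * m33" using m33 by (simp add: m22)
  have "m33 * (of_real \<delta> - of_real \<delta>' * (m11 * cnj m11)) = 0"
    using E3[of e1 e2] E3[of e1 "J e2"] ii cm22 m32 m34 unfolding ev by algebra
  then have "of_real \<delta> = of_real \<delta>' * (m11 * cnj m11)" using m33_nz by simp
  then have "complex_of_real \<delta> = of_real (\<delta>' * (cmod m11)\<^sup>2)"
    by (simp only: complex_norm_square of_real_mult)
  then have \<delta>_eq: "\<delta> = \<delta>' * (cmod m11)\<^sup>2" by (simp only: of_real_eq_iff)
  have sgn_eq: "\<delta>' = \<delta> \<and> s = 1" if "\<delta> = \<delta>' * s" "s > 0" for s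
    using that \<delta> \<delta>' by auto
  have "(cmod m11)\<^sup>2 > 0" using m11 by simp
  then have \<delta>\<delta>': "\<delta>' = \<delta>" and m1: "(cmod m11)\<^sup>2 = 1"
    using sgn_eq[OF \<delta>_eq] by auto
  have u: "m11 * cnj m11 = 1" using m1 by (metis complex_norm_square of_real_1)
  define r where "r = Re m33"
  have r: "m33 = of_real r" using m33 by (simp add: r_def complex_eq_iff)
  have E311: "m33 * of_real \<epsilon> = of_real \<epsilon>' + of_real \<delta>' * (m11 * cnj m21 - m21 * cnj m11)"
    using E3[of e1 "J e1"] ii m31 m32 m34 u unfolding ev by algebra
  have "Re (m33 * of_real \<epsilon>) = \<epsilon>'"
    unfolding E311 by simp
  then have r\<epsilon>: "r * \<epsilon> = \<epsilon>'" by (simp add: r)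
  have r0: "r \<noteq> 0" using m33_nz r by simp
  then have \<epsilon>\<epsilon>': "\<epsilon>' = \<epsilon>" and r1: "\<epsilon> = 0 \<or> r = 1"
    using r\<epsilon> \<epsilon> \<epsilon>' by auto

  have v2': "v2 X = m21 * w1 X + m11 * m33 * w2 X" for X
    using v2[of X] by (simp add: m22 m23 m24)
  note E4 = v.br4[unfolded v4 v2' v1' v3']
  have m43: "m43 = 0"
    using E4[of e2 e1] E4[of "J e2" e1] E4[of e2 "J e1"] E4[of "J e2" "J e1"] ii dd unfolding ev by algebra
  have a': "m44 * a = a' * m11\<^sup>2 * m33"
    using E4[of e1 e2] E4[of e1 "J e2"] ii m43 unfolding ev by algebra
  have \<nu>': "m44 * \<nu> = \<nu>' * m11 * m33\<^sup>2"
    using E4[of e2 e3] E4[of e2 "J e3"] ii unfolding ev by algebra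
  have B': "m44 * B = B'"
    using E4[of e1 "J e1"] ii m43 u unfolding ev by algebra
  have m44: "m44 \<noteq> 0"
  proof
    assume "m44 = 0"
    then have "v1 e4 = 0" "v2 e4 = 0" "v3 e4 = 0" "v4 e4 = 0"
      by (simp_all add: v1' v2' v3' v4 e4 m43)
    then have "e4 = 0" using cf' by (simp add: coframe_def)
    then show False using e4(4) by (simp add: coframe_apply)
  qed
  show ?thesis
    by (rule that[of m11 r m44]) (use \<epsilon>\<epsilon>' \<delta>\<delta>' u r0 m44 r1 a' \<nu>' B' r in auto)
qed

section \<open>The classification\<close>

theorem theorem3p1:
  fixes br :: "'a::real_vector \<Rightarrow> 'a \<Rightarrow> 'a" and J :: "'a \<Rightarrow> 'a"
  assumes "dim (UNIV :: 'a set) = 8"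
    and "nilpotent_lie_algebra br"
    and "complex_structure br J"
    and "weakly_non_nilpotent br J"
  shows "(\<exists>\<omega> \<epsilon> \<delta> \<nu> a B.
            basis_1_0 J 4 \<omega> \<and> admissible \<epsilon> \<delta> \<nu> a B \<and> structure_equations br \<omega> \<epsilon> \<delta> \<nu> a B)
       \<and> (\<forall>\<epsilon> \<delta> \<nu> a B. admissible \<epsilon> \<delta> \<nu> a B \<longrightarrow>
            (\<exists>(br\<^sub>0 :: 'a \<Rightarrow> 'a \<Rightarrow> 'a) J\<^sub>0 \<omega>\<^sub>0.
               nilpotent_lie_algebra br\<^sub>0 \<and> complex_structure br\<^sub>0 J\<^sub>0 \<and>
               weakly_non_nilpotent br\<^sub>0 J\<^sub>0 \<and>
               basis_1_0 J\<^sub>0 4 \<omega>\<^sub>0 \<and> structure_equations br\<^sub>0 \<omega>\<^sub>0 \<epsilon> \<delta> \<nu> a B))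
       \<and> (\<forall>\<omega> \<epsilon> \<delta> \<nu> a B (br' :: 'b::real_vector \<Rightarrow> 'b \<Rightarrow> 'b) J' \<omega>' \<epsilon>' \<delta>' \<nu>' a' B'.
            basis_1_0 J 4 \<omega> \<and> admissible \<epsilon> \<delta> \<nu> a B \<and> structure_equations br \<omega> \<epsilon> \<delta> \<nu> a B \<and>
            dim (UNIV :: 'b set) = 8 \<and> nilpotent_lie_algebra br' \<and>
            complex_structure br' J' \<and> weakly_non_nilpotent br' J' \<and>
            basis_1_0 J' 4 \<omega>' \<and> admissible \<epsilon>' \<delta>' \<nu>' a' B' \<and>
            structure_equations br' \<omega>' \<epsilon>' \<delta>' \<nu>' a' B' \<and>
            (\<epsilon>, \<delta>, \<nu>, a, B) \<noteq> (\<epsilon>', \<delta>', \<nu>', a', B') \<longrightarrow>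
            \<not> equivalent_structures br J br' J')"
proof (intro conjI)
  note nil = assms(2) and cpx = assms(3) and wnn = assms(4)
  have J: "linear J" "\<And>X. J (J X) = - X"
    using cpx by (simp_all add: complex_structure_def)
  obtain \<omega> \<epsilon> \<delta> \<nu> a B where cf: "coframe J (\<omega> 1) (\<omega> 2) (\<omega> 3) (\<omega> 4)"
    and adm: "admissible \<epsilon> \<delta> \<nu> a B" and eqs: "structure_equations br \<omega> \<epsilon> \<delta> \<nu> a B"
    by (rule ex_structure_equations[OF nil cpx wnn assms(1)])
  have basis: "basis_1_0 J 4 \<omega>"
    by (rule coframe_imp_basis[OF assms(1) cf])
  show "\<exists>\<omega> \<epsilon> \<delta> \<nu> a B.
      basis_1_0 J 4 \<omega> \<and> admissible \<epsilon> \<delta> \<nu> a B \<and> structure_equations br \<omega> \<epsilon> \<delta> \<nu> a B"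
    using basis adm eqs by blast
  show "\<forall>\<epsilon> \<delta> \<nu> a B. admissible \<epsilon> \<delta> \<nu> a B \<longrightarrow>
      (\<exists>(br\<^sub>0 :: 'a \<Rightarrow> 'a \<Rightarrow> 'a) J\<^sub>0 \<omega>\<^sub>0.
         nilpotent_lie_algebra br\<^sub>0 \<and> complex_structure br\<^sub>0 J\<^sub>0 \<and>
         weakly_non_nilpotent br\<^sub>0 J\<^sub>0 \<and>
         basis_1_0 J\<^sub>0 4 \<omega>\<^sub>0 \<and> structure_equations br\<^sub>0 \<omega>\<^sub>0 \<epsilon> \<delta> \<nu> a B)"
  proof (intro allI impI)
    fix \<epsilon> \<delta> \<nu> a :: real and B :: complex
    assume "admissible \<epsilon> \<delta> \<nu> a B"
    then have \<delta>: "\<delta> \<in> {1, -1}" by (simp add: admissible_def)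
    obtain br\<^sub>0 where eqs\<^sub>0:
      "full_eqs br\<^sub>0 (\<omega> 1) (\<omega> 2) (\<omega> 3) (\<omega> 4) \<epsilon> \<delta> (of_real \<nu>) (of_real a) B"
      by (rule ex_bracket_full_eqs[OF assms(1) cf])
    interpret m: full_eqs_algebra br\<^sub>0 J "\<omega> 1" "\<omega> 2" "\<omega> 3" "\<omega> 4" \<epsilon> \<delta> "of_real \<nu>" "of_real a" B
      by (rule full_eqs_algebra.intro) (fact J assms(1) cf eqs\<^sub>0 \<delta>)+
    have "nilpotent_lie_algebra br\<^sub>0 \<and> complex_structure br\<^sub>0 J \<and> weakly_non_nilpotent br\<^sub>0 J \<and>
        basis_1_0 J 4 \<omega> \<and> structure_equations br\<^sub>0 \<omega> \<epsilon> \<delta> \<nu> a B"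
      unfolding structure_equations_iff
      by (intro conjI m.nilpotent m.complex_structure m.weakly_non_nilpotent basis eqs\<^sub>0)
    then show "\<exists>(br\<^sub>0 :: 'a \<Rightarrow> 'a \<Rightarrow> 'a) J\<^sub>0 \<omega>\<^sub>0.
         nilpotent_lie_algebra br\<^sub>0 \<and> complex_structure br\<^sub>0 J\<^sub>0 \<and>
         weakly_non_nilpotent br\<^sub>0 J\<^sub>0 \<and>
         basis_1_0 J\<^sub>0 4 \<omega>\<^sub>0 \<and> structure_equations br\<^sub>0 \<omega>\<^sub>0 \<epsilon> \<delta> \<nu> a B"
      by (intro exI)
  qed
  show "\<forall>\<omega> \<epsilon> \<delta> \<nu> a B (br' :: 'b \<Rightarrow> 'b \<Rightarrow> 'b) J' \<omega>' \<epsilon>' \<delta>' \<nu>' a' B'.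
      basis_1_0 J 4 \<omega> \<and> admissible \<epsilon> \<delta> \<nu> a B \<and> structure_equations br \<omega> \<epsilon> \<delta> \<nu> a B \<and>
      dim (UNIV :: 'b set) = 8 \<and> nilpotent_lie_algebra br' \<and>
      complex_structure br' J' \<and> weakly_non_nilpotent br' J' \<and>
      basis_1_0 J' 4 \<omega>' \<and> admissible \<epsilon>' \<delta>' \<nu>' a' B' \<and>
      structure_equations br' \<omega>' \<epsilon>' \<delta>' \<nu>' a' B' \<and>
      (\<epsilon>, \<delta>, \<nu>, a, B) \<noteq> (\<epsilon>', \<delta>', \<nu>', a', B') \<longrightarrow>
      \<not> equivalent_structures br J br' J'"
  proof (intro allI impI notI, elim conjE)
    fix \<omega> \<epsilon> \<delta> \<nu> a B and br' :: "'b \<Rightarrow> 'b \<Rightarrow> 'b" and J' \<omega>' \<epsilon>' \<delta>' \<nu>' a' B'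
    assume basis: "basis_1_0 J 4 \<omega>" and adm: "admissible \<epsilon> \<delta> \<nu> a B"
      and eqs: "structure_equations br \<omega> \<epsilon> \<delta> \<nu> a B"
      and cpx': "complex_structure br' J'"
      and basis': "basis_1_0 J' 4 \<omega>'" and adm': "admissible \<epsilon>' \<delta>' \<nu>' a' B'"
      and eqs': "structure_equations br' \<omega>' \<epsilon>' \<delta>' \<nu>' a' B'"
      and neq: "(\<epsilon>, \<delta>, \<nu>, a, B) \<noteq> (\<epsilon>', \<delta>', \<nu>', a', B')"
    assume "equivalent_structures br J br' J'"
    then obtain f where f: "linear f" "bij f" "\<And>X Y. f (br X Y) = br' (f X) (f Y)" "f \<circ> J = J' \<circ> f"
      by (auto simp: equivalent_structures_def)
    have J': "linear J'" "\<And>X. J' (J' X) = - X"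
      using cpx' by (simp_all add: complex_structure_def)
    have in01: "\<epsilon> \<in> {0, 1}" "\<epsilon>' \<in> {0, 1}" "\<delta> \<in> {1, -1}" "\<delta>' \<in> {1, -1}"
      using adm adm' by (simp_all add: admissible_def)
    interpret m: full_eqs_algebra br J "\<omega> 1" "\<omega> 2" "\<omega> 3" "\<omega> 4" \<epsilon> \<delta> "of_real \<nu>" "of_real a" B
      by (rule full_eqs_algebra.intro)
         (fact J assms(1) basis_imp_coframe[OF J basis] eqs[unfolded structure_equations_iff] in01)+
    obtain u \<kappa> r where change: "\<epsilon>' = \<epsilon>" "\<delta>' = \<delta>" "u * cnj u = 1" "r \<noteq> 0" "\<kappa> \<noteq> 0" "\<epsilon> = 0 \<or> r = 1"
      "\<kappa> * of_real \<nu> = of_real \<nu>' * u * (of_real r)\<^sup>2"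
      "\<kappa> * of_real a = of_real a' * u\<^sup>2 * of_real r" "\<kappa> * B = B'"
      by (rule m.change_of_coframe[OF
            coframe_pullback[OF f(1,2,4) basis_imp_coframe[OF J' basis']]
            full_eqs_pullback[OF f(3) eqs'[unfolded structure_equations_iff]] in01(4,1,2)])
    have "(\<nu>, a, B) = (\<nu>', a', B')"
      by (rule normal_form_unique[OF adm adm'[unfolded change(1,2)] change(3-9)])
    with neq change(1,2) show False by simp
  qed
qed

end
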